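(* Let $a,b,c$ be positive numbers with $a<b<c$, and set $c_0=c-\lfloor c/b\rfloor b$. (VI) Suppose $c_0\ge a$ and $c_0>b-a$. Then $\mathcal G(\chi_{[0,c)},a\mathbb Z\times\mathbb Z/b)$ is not a Gabor frame if and only if $a/b=p/q$ for some coprime positive integers $p,q$ and one of the following holds: 1) $c_0>b-\gcd(\lfloor c/b\rfloor+1,p)\,b/q$ and $\gcd(\lfloor c/b\rfloor+1,p)\ne\lfloor c/b\rfloor+1$; 2) $c_0>b-\gcd(\lfloor c/b\rfloor+1,p)\,b/q+b/q$ and $\gcd(\lfloor c/b\rfloor+1,p)=\lfloor c/b\rfloor+1$. (VII) Suppose $c_0<a$ and $c_0\le b-a$. Then $\mathcal G(\chi_{[0,c)},a\mathbb Z\times\mathbb Z/b)$ is not a Gabor frame if and only if one of the following holds: 3) $c_0=0$; 4) $a/b=p/q$ for some coprime positive integers $p,q$, $0<c_0<\gcd(\lfloor c/b\rfloor,p)\,b/q$, and $\gcd(\lfloor c/b\rfloor,p)\ne\lfloor c/b\rfloor$; 5) $a/b=p/q$ for some coprime positive integers $p,q$, $0<c_0<\gcd(\lfloor c/b\rfloor,p)\,b/q-b/q$, and $\gcd(\lfloor c/b\rfloor,p)=\lfloor c/b\rfloor$.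
   Context: For $\phi\in L^2(\mathbb R)$ and $a,b>0$, the Gabor system is $\mathcal G(\phi,a\mathbb Z\times\mathbb Z/b)=\{e^{-2\pi i n t/b}\phi(t-ma): (m,n)\in\mathbb Z\times\mathbb Z\}$. It is called a Gabor frame if it is a frame for $L^2(\mathbb R)$: there are constants $0<A\le B<\infty$ such that $A\|f\|_2^2\le\sum_{\psi\in\mathcal G}|\langle f,\psi\rangle|^2\le B\|f\|_2^2$ for all $f\in L^2(\mathbb R)$. $\chi_E$ is the indicator function of $E$, $\lfloor x\rfloor$ is the integer part of $x$, and $\gcd$ of two positive integers is their usual greatest common divisor. *)

theory Defs
  imports "HOL-Analysis.Analysis"
begin

definition L2 :: "(real \<Rightarrow> complex) \<Rightarrow> bool" where
  "L2 f \<longleftrightarrow> f \<in> borel_measurable lborel \<and> integrable lborel (\<lambda>t. (cmod (f t))^2)"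

definition L2_inner :: "(real \<Rightarrow> complex) \<Rightarrow> (real \<Rightarrow> complex) \<Rightarrow> complex" where
  "L2_inner f g = (LINT t|lborel. f t * cnj (g t))"

definition L2_normsq :: "(real \<Rightarrow> complex) \<Rightarrow> real" where
  "L2_normsq f = (LINT t|lborel. (cmod (f t))^2)"

definition gabor_atom :: "(real \<Rightarrow> complex) \<Rightarrow> real \<Rightarrow> real \<Rightarrow> int \<Rightarrow> int \<Rightarrow> real \<Rightarrow> complex" where
  "gabor_atom \<phi> a b m n = (\<lambda>t. exp (- 2 * complex_of_real pi * \<i> * of_int n * complex_of_real t
        / complex_of_real b) * \<phi> (t - of_int m * a))"

definition gabor_frame :: "(real \<Rightarrow> complex) \<Rightarrow> real \<Rightarrow> real \<Rightarrow> bool" where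
  "gabor_frame \<phi> a b \<longleftrightarrow>
     (\<exists>A B. 0 < A \<and> A \<le> B \<and>
       (\<forall>f. L2 f \<longrightarrow>
          (\<lambda>(m,n). (cmod (L2_inner f (gabor_atom \<phi> a b m n)))^2) summable_on (UNIV :: (int \<times> int) set) \<and>
          A * L2_normsq f \<le> (\<Sum>\<^sub>\<infinity>(m,n)\<in>(UNIV :: (int \<times> int) set). (cmod (L2_inner f (gabor_atom \<phi> a b m n)))^2) \<and>
          (\<Sum>\<^sub>\<infinity>(m,n)\<in>(UNIV :: (int \<times> int) set). (cmod (L2_inner f (gabor_atom \<phi> a b m n)))^2) \<le> B * L2_normsq f))"

end

theory Submission
  imports Defs
begin

text \<open>
  Write \<open>f\<close> on a coset \<open>t + b\<int>\<close> as a sequence \<open>v\<close>. By Parseval's identity on \<open>[0, b)\<close> the frame sum of \<open>f\<close>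
  is \<open>b\<close> times the integral over \<open>t\<close> of the squared norms of the rows of \<open>v\<close>, the row of \<open>m\<close> being the sum of \<open>v\<close> over the
  points of the coset in \<open>[ma, ma + c)\<close> (Ron--Shen duality).
  Put \<open>N = k + 1\<close>, \<open>L = b - c\<^sub>0\<close> in case (VI) and \<open>N = k\<close>, \<open>L = c\<^sub>0\<close> in case (VII). Then every window of \<open>N\<close> consecutive
  samples is a row, and the other rows are such windows with one sample added or removed, which happens
  when the coset meets an arc of length \<open>L\<close> modulo \<open>a\<close>. So the rows vanish iff \<open>v\<close> is \<open>N\<close>-periodic
  with zero sum over a period and vanishes on the classes modulo \<open>N\<close> that hit the arc.
  Such \<open>v \<noteq> 0\<close> exist iff at least two classes miss the arc. For irrational \<open>a / b\<close> and \<open>L > 0\<close> every class hits it,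
  with bounded waiting time, by Dirichlet's approximation theorem; for \<open>a / b = p / q\<close> the class of \<open>r\<close> visits
  a translate of \<open>gcd N p \<cdot> (b / q) \<int>\<close>, and counting the points in the arc gives the stated conditions.
  When at most one class misses the arc, \<open>v\<close> is bounded by boundedly many neighbouring rows, so the lower
  frame bound holds; otherwise truncations of an \<open>N\<close>-periodic null vector violate it.
\<close>

subsection \<open>Trigonometric approximation in \<open>L\<^sup>2[0, b)\<close>\<close>

text \<open>Encoded as a density on the whole line, so that the space stays \<open>UNIV\<close> and
  functions on the line are integrated over one period without being restricted first.\<close>

definition period_measure :: "real \<Rightarrow> real measure" where
  "period_measure b = density lborel (\<lambda>s. ennreal (indicator {0..<b} s))"

text \<open>The conjugate of the exponential in \<open>gabor_atom\<close>, so that frame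
  coefficients become integrals against \<open>character b n\<close> without a change of
  sign.\<close>

definition character :: "real \<Rightarrow> int \<Rightarrow> real \<Rightarrow> complex" where
  "character b n s = cis (2 * pi * of_int n * s / b)"

lemma sets_period_measure [simp, measurable_cong]: "sets (period_measure b) = sets borel"
  by (simp add: period_measure_def)

lemma space_period_measure [simp]: "space (period_measure b) = UNIV"
  by (simp add: period_measure_def)

lemma nn_integral_period_measure:
  assumes [measurable]: "g \<in> borel_measurable borel"
  shows "(\<integral>\<^sup>+s. g s \<partial>period_measure b) = (\<integral>\<^sup>+s. g s * indicator {0..<b} s \<partial>lborel)"
  unfolding period_measure_def
  by (subst nn_integral_density) (auto intro!: nn_integral_cong simp: mult.commute split: split_indicator)

lemma integral_period_measure:
  fixes g :: "real \<Rightarrow> 'a::{banach, second_countable_topology}"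
  assumes [measurable]: "g \<in> borel_measurable borel"
  shows "(\<integral>s. g s \<partial>period_measure b) = (\<integral>s. indicator {0..<b} s *\<^sub>R g s \<partial>lborel)"
  unfolding period_measure_def by (rule integral_density) auto

lemma AE_period_measure:
  assumes "AE s in lborel. s \<in> {0..<b} \<longrightarrow> P s"
  shows "AE s in period_measure b. P s"
  unfolding period_measure_def
  by (subst AE_density) (use assms in \<open>auto elim!: eventually_mono split: split_indicator\<close>)

lemma emeasure_period_measure:
  "b \<ge> 0 \<Longrightarrow> emeasure (period_measure b) UNIV = ennreal b"
  using nn_integral_period_measure[of "\<lambda>_. 1" b] by simp

lemma finite_measure_period_measure: "b \<ge> 0 \<Longrightarrow> finite_measure (period_measure b)"
  by (rule finite_measureI) (simp add: emeasure_period_measure)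

lemma character_measurable [measurable]: "character b n \<in> borel_measurable borel"
  unfolding character_def[abs_def] cis_conv_exp by measurable

lemma norm_character [simp]: "cmod (character b n s) = 1"
  by (simp add: character_def)

lemma character_0 [simp]: "character b 0 s = 1"
  by (simp add: character_def)

lemma character_mult: "character b n s * character b m s = character b (n + m) s"
  by (simp add: character_def cis_mult add_divide_distrib algebra_simps)

lemma cnj_character: "cnj (character b n s) = character b (- n) s"
  by (simp add: character_def cis_cnj)

lemma character_add: "character b n (s + t) = character b n s * character b n t"
  by (simp add: character_def cis_mult add_divide_distrib algebra_simps)

lemma character_period [simp]: "b \<noteq> 0 \<Longrightarrow> character b n (of_int i * b) = 1"
  using cis_multiple_2pi[of "of_int (n * i)"] by (simp add: character_def mult_ac)

lemma integral_character:
  assumes "b > 0"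
  shows "(\<integral>s. character b n s \<partial>period_measure b) = (if n = 0 then of_real b else 0)"
proof (cases "n = 0")
  case True
  then show ?thesis
    using emeasure_period_measure[of b] assms
    by (simp add: character_def measure_def scaleR_conv_of_real)
next
  case False
  define w where "w = 2 * pi * of_int n / b"
  have w: "w \<noteq> 0" using False assms by (simp add: w_def)
  \<comment> \<open>A primitive of the character; periodicity makes it agree at \<open>0\<close> and
    \<open>b\<close>, so its increment over the period is zero.\<close>
  define F where "F = (\<lambda>s. cis (w * s) / (\<i> * of_real w))"
  have der: "(F has_vector_derivative cis (w * s)) (at s within {0..b})" for s
  proof -
    have "((\<lambda>z. exp (\<i> * of_real w * z) / (\<i> * of_real w)) has_field_derivative exp (\<i> * of_real w * of_real s))
        (at (of_real s))"
      using w by (auto intro!: derivative_eq_intros)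
    from has_vector_derivative_real_field[OF this] show ?thesis
      by (simp add: F_def cis_conv_exp mult.assoc)
  qed
  have "(\<integral>s. indicator {0..b} s *\<^sub>R cis (w * s) \<partial>lborel) = F b - F 0"
    by (rule integral_FTC_Icc) (use assms der in \<open>auto intro!: continuous_intros\<close>)
  also have "F b = F 0"
  proof -
    have "cis (w * b) = 1"
      using assms cis_multiple_2pi[of "of_int n"] by (simp add: w_def)
    then show ?thesis by (simp add: F_def)
  qed
  finally have *: "(\<integral>s. indicator {0..b} s *\<^sub>R cis (w * s) \<partial>lborel) = 0" by simp
  have "(\<integral>s. character b n s \<partial>period_measure b) = (\<integral>s. indicator {0..<b} s *\<^sub>R character b n s \<partial>lborel)"
    by (rule integral_period_measure) simp
  also have "\<dots> = (\<integral>s. indicator {0..b} s *\<^sub>R cis (w * s) \<partial>lborel)"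
  proof (rule integral_cong_AE)
    show "AE s in lborel. indicator {0..<b} s *\<^sub>R character b n s = indicator {0..b} s *\<^sub>R cis (w * s)"
      using AE_lborel_singleton[of b]
      by eventually_elim (auto simp: character_def w_def split: split_indicator)
    show "(\<lambda>s. indicator {0..b} s *\<^sub>R cis (w * s)) \<in> borel_measurable lborel"
      unfolding cis_conv_exp by measurable
  qed auto
  finally show ?thesis using False * by simp
qed

section \<open>Trigonometric polynomials\<close>

inductive trig_poly :: "real \<Rightarrow> (real \<Rightarrow> complex) \<Rightarrow> bool" for b where
  character: "trig_poly b (\<lambda>s. z * character b n s)"
| add: "trig_poly b f \<Longrightarrow> trig_poly b g \<Longrightarrow> trig_poly b (\<lambda>s. f s + g s)"

lemma trig_poly_const: "trig_poly b (\<lambda>s. z)"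
  using trig_poly.character[of b z 0] by simp

lemma trig_poly_mult:
  assumes "trig_poly b f" "trig_poly b g"
  shows "trig_poly b (\<lambda>s. f s * g s)"
  using assms
proof (induction rule: trig_poly.induct)
  case (character z n)
  then show ?case
  proof (induction rule: trig_poly.induct)
    case (character z' m)
    have "(\<lambda>s. z * character b n s * (z' * character b m s)) = (\<lambda>s. (z * z') * character b (n + m) s)"
      by (simp add: character_mult[symmetric] algebra_simps)
    then show ?case using trig_poly.character[of b "z * z'" "n + m"] by simp
  next
    case (add f g)
    then show ?case by (simp add: distrib_left trig_poly.add)
  qed
next
  case (add f g)
  then show ?case by (simp add: distrib_right trig_poly.add)
qed

lemma trig_poly_sum:
  "(\<And>i. i \<in> I \<Longrightarrow> trig_poly b (f i)) \<Longrightarrow> trig_poly b (\<lambda>s. \<Sum>i\<in>I. f i s)"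
  by (induction I rule: infinite_finite_induct) (auto intro: trig_poly_const trig_poly.add)

lemma trig_poly_power: "trig_poly b f \<Longrightarrow> trig_poly b (\<lambda>s. f s ^ n)"
  by (induction n) (auto intro: trig_poly_const trig_poly_mult)

lemma trig_poly_measurable: "trig_poly b f \<Longrightarrow> f \<in> borel_measurable borel"
  by (induction rule: trig_poly.induct) auto

lemma trig_poly_expansion:
  assumes "trig_poly b f"
  obtains S z where "finite S" "f = (\<lambda>s. \<Sum>n\<in>S. z n * character b n s)"
proof -
  have "\<exists>S z. finite S \<and> f = (\<lambda>s. \<Sum>n\<in>S. z n * character b n s)"
    using assms
  proof (induction rule: trig_poly.induct)
    case (character z n)
    show ?case by (rule exI[of _ "{n}"], rule exI[of _ "\<lambda>_. z"]) simp
  next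
    case (add f g)
    then obtain S z T y where ST: "finite S" "finite T"
      and f: "f = (\<lambda>s. \<Sum>n\<in>S. z n * character b n s)"
      and g: "g = (\<lambda>s. \<Sum>n\<in>T. y n * character b n s)" by blast
    \<comment> \<open>Both coefficient families are extended by zero to the union of the supports,
      so that they can be added termwise.\<close>
    have "f = (\<lambda>s. \<Sum>n\<in>S \<union> T. (if n \<in> S then z n else 0) * character b n s)"
      "g = (\<lambda>s. \<Sum>n\<in>S \<union> T. (if n \<in> T then y n else 0) * character b n s)"
      unfolding f g using ST by (auto intro!: ext sum.mono_neutral_cong_left)
    then have "(\<lambda>s. f s + g s) =
      (\<lambda>s. \<Sum>n\<in>S \<union> T. ((if n \<in> S then z n else 0) + (if n \<in> T then y n else 0)) * character b n s)"
      by (simp add: sum.distrib distrib_right)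
    with ST(1,2) show ?case
      by (intro exI[of _ "S \<union> T"] exI[of _ "\<lambda>n. (if n \<in> S then z n else 0) + (if n \<in> T then y n else 0)"]) simp
  qed
  with that show ?thesis by blast
qed

section \<open>Square-mean closure of the trigonometric polynomials\<close>

definition trig_approximable :: "real \<Rightarrow> (real \<Rightarrow> complex) \<Rightarrow> bool" where
  "trig_approximable b f \<longleftrightarrow> f \<in> borel_measurable borel \<and>
     (\<forall>e>0. \<exists>P. trig_poly b P \<and>
        (\<integral>\<^sup>+s. ennreal ((cmod (f s - P s))\<^sup>2) \<partial>period_measure b) < ennreal e)"

lemma cmod_add_square_le: "(cmod (x + y))\<^sup>2 \<le> 2 * (cmod x)\<^sup>2 + 2 * (cmod y)\<^sup>2"
proof -
  have "(cmod (x + y))\<^sup>2 \<le> (cmod x + cmod y)\<^sup>2"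
    by (intro power_mono norm_triangle_ineq) auto
  also have "\<dots> \<le> 2 * (cmod x)\<^sup>2 + 2 * (cmod y)\<^sup>2"
    using sum_squares_bound[of "cmod x" "cmod y"] by (simp add: power2_sum)
  finally show ?thesis .
qed

lemma nn_integral_cmod_add_square_le:
  assumes [measurable]: "f \<in> borel_measurable M" "g \<in> borel_measurable M"
  shows "(\<integral>\<^sup>+s. ennreal ((cmod (f s + g s))\<^sup>2) \<partial>M)
    \<le> 2 * (\<integral>\<^sup>+s. ennreal ((cmod (f s))\<^sup>2) \<partial>M) + 2 * (\<integral>\<^sup>+s. ennreal ((cmod (g s))\<^sup>2) \<partial>M)"
proof -
  have "(\<integral>\<^sup>+s. ennreal ((cmod (f s + g s))\<^sup>2) \<partial>M)
    \<le> (\<integral>\<^sup>+s. 2 * ennreal ((cmod (f s))\<^sup>2) + 2 * ennreal ((cmod (g s))\<^sup>2) \<partial>M)"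
  proof (rule nn_integral_mono)
    fix s
    have "ennreal ((cmod (f s + g s))\<^sup>2) \<le> ennreal (2 * (cmod (f s))\<^sup>2 + 2 * (cmod (g s))\<^sup>2)"
      by (intro ennreal_leI cmod_add_square_le)
    then show "ennreal ((cmod (f s + g s))\<^sup>2) \<le> 2 * ennreal ((cmod (f s))\<^sup>2) + 2 * ennreal ((cmod (g s))\<^sup>2)"
      by (simp add: ennreal_plus ennreal_mult)
  qed
  also have "\<dots> = 2 * (\<integral>\<^sup>+s. ennreal ((cmod (f s))\<^sup>2) \<partial>M) + 2 * (\<integral>\<^sup>+s. ennreal ((cmod (g s))\<^sup>2) \<partial>M)"
    by (simp add: nn_integral_add nn_integral_cmult)
  finally show ?thesis .
qed

text \<open>Accounts for the factor 2 in \<open>nn_integral_cmod_add_square_le\<close>: two squared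
  errors below \<open>e / 4\<close> combine to one below \<open>e\<close>.\<close>

lemma two_ennreal_mult_less: "x < ennreal (e / 4) \<Longrightarrow> y < ennreal (e / 4) \<Longrightarrow> e > 0 \<Longrightarrow> 2 * x + 2 * y < ennreal e"
proof -
  assume *: "x < ennreal (e / 4)" "y < ennreal (e / 4)" "e > 0"
  obtain x' where x': "x = ennreal x'" "x' \<ge> 0" using *(1) by (cases x) auto
  obtain y' where y': "y = ennreal y'" "y' \<ge> 0" using *(2) by (cases y) auto
  have "2 * x + 2 * y = ennreal (2 * x' + 2 * y')"
    using x' y' by (simp add: ennreal_plus ennreal_mult)
  also have "\<dots> < ennreal e"
    using * x' y' by (intro ennreal_lessI) (auto simp: ennreal_less_iff)
  finally show ?thesis .
qed

lemma trig_approximable_trig_poly: "trig_poly b f \<Longrightarrow> trig_approximable b f"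
  unfolding trig_approximable_def using trig_poly_measurable by (auto intro!: exI[of _ f])

lemma trig_approximable_add:
  assumes f: "trig_approximable b f" and g: "trig_approximable b g"
  shows "trig_approximable b (\<lambda>s. f s + g s)"
  unfolding trig_approximable_def
proof (intro conjI allI impI)
  have [measurable]: "f \<in> borel_measurable borel" "g \<in> borel_measurable borel"
    using f g by (auto simp: trig_approximable_def)
  show "(\<lambda>s. f s + g s) \<in> borel_measurable borel" by measurable
  fix e :: real assume "e > 0"
  then have "e / 4 > 0" by simp
  then obtain P Q where P: "trig_poly b P" "(\<integral>\<^sup>+s. ennreal ((cmod (f s - P s))\<^sup>2) \<partial>period_measure b) < ennreal (e / 4)"
    and Q: "trig_poly b Q" "(\<integral>\<^sup>+s. ennreal ((cmod (g s - Q s))\<^sup>2) \<partial>period_measure b) < ennreal (e / 4)"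
    using f g unfolding trig_approximable_def by meson
  have [measurable]: "P \<in> borel_measurable borel" "Q \<in> borel_measurable borel"
    using P Q trig_poly_measurable by auto
  have "(\<integral>\<^sup>+s. ennreal ((cmod ((f s - P s) + (g s - Q s)))\<^sup>2) \<partial>period_measure b) < ennreal e"
    by (rule le_less_trans[OF nn_integral_cmod_add_square_le])
      (use P Q \<open>e > 0\<close> in \<open>auto intro!: two_ennreal_mult_less\<close>)
  then show "\<exists>R. trig_poly b R \<and> (\<integral>\<^sup>+s. ennreal ((cmod (f s + g s - R s))\<^sup>2) \<partial>period_measure b) < ennreal e"
    by (intro exI[of _ "\<lambda>s. P s + Q s"]) (use P Q in \<open>auto intro: trig_poly.add simp: algebra_simps\<close>)
qed

lemma trig_approximable_cmult:
  assumes f: "trig_approximable b f"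
  shows "trig_approximable b (\<lambda>s. z * f s)"
proof (cases "z = 0")
  case True
  then show ?thesis by (simp add: trig_approximable_trig_poly trig_poly_const)
next
  case False
  have [measurable]: "f \<in> borel_measurable borel"
    using f by (auto simp: trig_approximable_def)
  show ?thesis
    unfolding trig_approximable_def
  proof (intro conjI allI impI)
    show "(\<lambda>s. z * f s) \<in> borel_measurable borel" by measurable
    fix e :: real assume e: "e > 0"
    then have "e / (cmod z)\<^sup>2 > 0" using False by simp
    then obtain P where P: "trig_poly b P" "(\<integral>\<^sup>+s. ennreal ((cmod (f s - P s))\<^sup>2) \<partial>period_measure b) < ennreal (e / (cmod z)\<^sup>2)"
      using f unfolding trig_approximable_def by meson
    have [measurable]: "P \<in> borel_measurable borel"
      using P trig_poly_measurable by auto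
    have "(\<integral>\<^sup>+s. ennreal ((cmod (z * f s - z * P s))\<^sup>2) \<partial>period_measure b)
      = (\<integral>\<^sup>+s. ennreal ((cmod z)\<^sup>2) * ennreal ((cmod (f s - P s))\<^sup>2) \<partial>period_measure b)"
      by (simp add: ennreal_mult[symmetric] norm_mult[symmetric] power_mult_distrib[symmetric] algebra_simps)
    also have "\<dots> = ennreal ((cmod z)\<^sup>2) * (\<integral>\<^sup>+s. ennreal ((cmod (f s - P s))\<^sup>2) \<partial>period_measure b)"
      by (rule nn_integral_cmult) measurable
    also have "\<dots> < ennreal ((cmod z)\<^sup>2) * ennreal (e / (cmod z)\<^sup>2)"
      using P(2) False by (intro ennreal_mult_strict_left_mono) (auto simp: ennreal_zero_less_mult_iff)
    also have "\<dots> = ennreal e" using False e by (simp add: ennreal_mult[symmetric])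
    finally show "\<exists>R. trig_poly b R \<and> (\<integral>\<^sup>+s. ennreal ((cmod (z * f s - R s))\<^sup>2) \<partial>period_measure b) < ennreal e"
      using trig_poly_mult[OF trig_poly_const P(1)] by blast
  qed
qed

lemma trig_approximable_sum:
  "(\<And>i. i \<in> I \<Longrightarrow> trig_approximable b (f i)) \<Longrightarrow> trig_approximable b (\<lambda>s. \<Sum>i\<in>I. f i s)"
  by (induction I rule: infinite_finite_induct)
    (auto intro: trig_approximable_trig_poly trig_poly_const trig_approximable_add)

text \<open>Dominated convergence: squared errors dominated by the integrable \<open>w\<close> tend
  to zero in mean, so some \<open>F n\<close> is close to \<open>f\<close>, and a trigonometric
  polynomial close to \<open>F n\<close> serves for \<open>f\<close>.\<close>

lemma trig_approximable_limit:
  assumes F: "\<And>n::nat. trig_approximable b (F n)" and [measurable]: "f \<in> borel_measurable borel"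
    and [measurable]: "w \<in> borel_measurable borel"
    and bound: "\<And>n. AE s in period_measure b. ennreal ((cmod (f s - F n s))\<^sup>2) \<le> w s"
    and w: "(\<integral>\<^sup>+s. w s \<partial>period_measure b) < \<infinity>"
    and lim: "AE s in period_measure b. (\<lambda>n. F n s) \<longlonglongrightarrow> f s"
  shows "trig_approximable b f"
  unfolding trig_approximable_def
proof (intro conjI allI impI)
  show "f \<in> borel_measurable borel" by measurable
  have [measurable]: "F n \<in> borel_measurable borel" for n
    using F by (auto simp: trig_approximable_def)
  fix e :: real assume e: "e > 0"
  have "(\<lambda>n. \<integral>\<^sup>+s. ennreal ((cmod (f s - F n s))\<^sup>2) \<partial>period_measure b) \<longlonglongrightarrow> (\<integral>\<^sup>+s. 0 \<partial>period_measure b)"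
  proof (rule nn_integral_dominated_convergence[where w = w])
    show "AE s in period_measure b. (\<lambda>n. ennreal ((cmod (f s - F n s))\<^sup>2)) \<longlonglongrightarrow> 0"
      using lim
    proof eventually_elim
      case (elim s)
      have "(\<lambda>n. ennreal ((cmod (f s - F n s))\<^sup>2)) \<longlonglongrightarrow> ennreal ((cmod (f s - f s))\<^sup>2)"
        by (intro tendsto_intros elim)
      then show ?case by simp
    qed
  qed (use bound w in auto)
  then have "eventually (\<lambda>n. (\<integral>\<^sup>+s. ennreal ((cmod (f s - F n s))\<^sup>2) \<partial>period_measure b) < ennreal (e / 4)) sequentially"
    by (rule order_tendstoD(2)) (use e in simp)
  then obtain n where n: "(\<integral>\<^sup>+s. ennreal ((cmod (f s - F n s))\<^sup>2) \<partial>period_measure b) < ennreal (e / 4)"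
    by (auto simp: eventually_sequentially)
  have "e / 4 > 0" using e by simp
  then obtain P where P: "trig_poly b P" "(\<integral>\<^sup>+s. ennreal ((cmod (F n s - P s))\<^sup>2) \<partial>period_measure b) < ennreal (e / 4)"
    using F[of n] unfolding trig_approximable_def by meson
  have [measurable]: "P \<in> borel_measurable borel"
    using P trig_poly_measurable by auto
  have "(\<integral>\<^sup>+s. ennreal ((cmod ((f s - F n s) + (F n s - P s)))\<^sup>2) \<partial>period_measure b) < ennreal e"
    by (rule le_less_trans[OF nn_integral_cmod_add_square_le])
      (use P n e in \<open>auto intro!: two_ennreal_mult_less\<close>)
  then show "\<exists>R. trig_poly b R \<and> (\<integral>\<^sup>+s. ennreal ((cmod (f s - R s))\<^sup>2) \<partial>period_measure b) < ennreal e"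
    using P(1) by auto
qed

lemma trig_approximable_AE_const:
  assumes f: "AE s in period_measure b. f s = z" and [measurable]: "f \<in> borel_measurable borel"
  shows "trig_approximable b f"
proof (rule trig_approximable_limit[where F = "\<lambda>_ _. z" and w = "\<lambda>_. 0"])
  show "AE s in period_measure b. ennreal ((cmod (f s - z))\<^sup>2) \<le> 0"
    using f by eventually_elim simp
  show "AE s in period_measure b. (\<lambda>n. z) \<longlonglongrightarrow> f s"
    using f by eventually_elim simp
qed (auto intro: trig_approximable_trig_poly trig_poly_const)

lemma trig_poly_cos: "trig_poly b (\<lambda>s. of_real (cos (2 * pi * s / b - \<theta>)))"
proof -
  have "complex_of_real (cos (2 * pi * s / b - \<theta>)) =
    cis (- \<theta>) / 2 * character b 1 s + cis \<theta> / 2 * character b (- 1) s" for s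
    by (simp add: complex_eq_iff character_def cos_diff add_divide_distrib[symmetric])
  then show ?thesis
    by (simp only:) (intro trig_poly.character trig_poly.add)
qed

text \<open>A polynomial in a cosine is a trigonometric polynomial, so uniform approximation of
  \<phi> on \<open>[-1, 1]\<close> by polynomials suffices.\<close>

lemma trig_approximable_continuous_cos:
  assumes "b > 0" and \<phi>: "continuous_on UNIV \<phi>"
  shows "trig_approximable b (\<lambda>s. of_real (\<phi> (cos (2 * pi * s / b - \<theta>))))"
  unfolding trig_approximable_def
proof (intro conjI allI impI)
  have [measurable]: "\<phi> \<in> borel_measurable borel" by (rule borel_measurable_continuous_onI[OF \<phi>])
  show "(\<lambda>s. complex_of_real (\<phi> (cos (2 * pi * s / b - \<theta>)))) \<in> borel_measurable borel" by measurable
  fix e :: real assume e: "e > 0"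
  \<comment> \<open>A uniform error \<open>d\<close> costs \<open>d^2 * b = e / 2\<close> over the
    period, which leaves room for the strict inequality.\<close>
  define d where "d = sqrt (e / (2 * b))"
  have d: "d > 0" "d\<^sup>2 = e / (2 * b)" using e \<open>b > 0\<close> by (auto simp: d_def)
  obtain g where g: "real_polynomial_function g" "\<And>x. x \<in> {-1..1} \<Longrightarrow> \<bar>\<phi> x - g x\<bar> < d"
    using Stone_Weierstrass_real_polynomial_function[of "{-1..1}" \<phi> d] continuous_on_subset[OF \<phi>] d(1)
    by auto
  obtain A n where gs: "g = (\<lambda>x. \<Sum>i\<le>n. A i * x ^ i)"
    using g(1) unfolding real_polynomial_function_iff_sum by blast
  define P where "P = (\<lambda>s. complex_of_real (g (cos (2 * pi * s / b - \<theta>))))"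
  have P: "trig_poly b P"
    unfolding P_def gs of_real_sum of_real_mult of_real_power
    by (intro trig_poly_sum trig_poly_mult trig_poly_const trig_poly_power trig_poly_cos)
  have "(\<integral>\<^sup>+s. ennreal ((cmod (of_real (\<phi> (cos (2 * pi * s / b - \<theta>))) - P s))\<^sup>2) \<partial>period_measure b)
    \<le> (\<integral>\<^sup>+s. ennreal (d\<^sup>2) \<partial>period_measure b)"
  proof (rule nn_integral_mono)
    fix s
    define y where "y = cos (2 * pi * s / b - \<theta>)"
    have "\<bar>\<phi> y - g y\<bar> \<le> d" using g(2)[of y] by (simp add: y_def)
    moreover have "cmod (of_real (\<phi> y) - P s) = \<bar>\<phi> y - g y\<bar>"
      unfolding P_def y_def[symmetric] by (metis norm_of_real of_real_diff)
    ultimately have "(cmod (of_real (\<phi> y) - P s))\<^sup>2 \<le> d\<^sup>2"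
      by (metis abs_ge_zero power_mono)
    then show "ennreal ((cmod (of_real (\<phi> (cos (2 * pi * s / b - \<theta>))) - P s))\<^sup>2) \<le> ennreal (d\<^sup>2)"
      unfolding y_def by (rule ennreal_leI)
  qed
  also have "\<dots> = ennreal (e / 2)"
    using emeasure_period_measure[of b] \<open>b > 0\<close> d e by (simp add: ennreal_mult[symmetric])
  also have "\<dots> < ennreal e" using e by (simp add: ennreal_less_iff)
  finally show "\<exists>P. trig_poly b P \<and>
    (\<integral>\<^sup>+s. ennreal ((cmod (of_real (\<phi> (cos (2 * pi * s / b - \<theta>))) - P s))\<^sup>2) \<partial>period_measure b) < ennreal e"
    using P by blast
qed

lemma nn_integral_period_measure_const_finite:
  "b > 0 \<Longrightarrow> (\<integral>\<^sup>+s. ennreal K \<partial>period_measure b) < \<infinity>"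
  using emeasure_period_measure[of b] by (simp add: ennreal_mult_less_top)

text \<open>On the circle the arc \<open>(0, x)\<close> is cut out by the half-plane \<open>cos (2\<pi>s/b - \<pi>x/b) > cos (\<pi>x/b)\<close>,
  so that Weierstrass' theorem in one real variable suffices.\<close>

lemma cos_gt_iff_arc:
  assumes "0 < x" "x < b" "0 < s" "s < b"
  shows "cos (2 * pi * s / b - pi * x / b) > cos (pi * x / b) \<longleftrightarrow> s < x"
proof -
  define u where "u = 2 * pi * s / b - pi * x / b"
  define v where "v = pi * x / b"
  have v: "0 < v" "v < pi" using assms by (auto simp: v_def field_simps)
  have u: "- v < u" "u < 2 * pi - v" using assms by (auto simp: u_def v_def field_simps)
  have sx: "s < x \<longleftrightarrow> u < v" using assms by (auto simp: u_def v_def field_simps)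
  have "cos u > cos v \<longleftrightarrow> u < v"
  proof
    assume "u < v"
    then have "cos v < cos \<bar>u\<bar>" using u v by (intro cos_monotone_0_pi) auto
    then show "cos u > cos v" by simp
  next
    assume c: "cos u > cos v"
    show "u < v"
    proof (rule ccontr)
      assume "\<not> u < v"
      then have uv: "v \<le> u" by simp
      show False
      proof (cases "u \<le> pi")
        case True
        then have "cos u \<le> cos v" using uv v by (intro cos_monotone_0_pi_le) auto
        with c show False by simp
      next
        case False
        then have "cos (2 * pi - u) \<le> cos v" using u v by (intro cos_monotone_0_pi_le) auto
        with c show False by (simp add: cos_diff)
      qed
    qed
  qed
  then show ?thesis using sx by (simp add: u_def v_def)
qed

lemma trig_approximable_lessThan:
  assumes b: "b > 0"
  shows "trig_approximable b (indicator {..<x})"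
proof -
  consider "x \<le> 0" | "x \<ge> b" | "0 < x" "x < b" by linarith
  then show ?thesis
  proof cases
    case 1
    have "AE s in period_measure b. indicator {..<x} s = (0 :: complex)"
      by (rule AE_period_measure) (use 1 in \<open>auto split: split_indicator\<close>)
    then show ?thesis by (rule trig_approximable_AE_const) simp
  next
    case 2
    have "AE s in period_measure b. indicator {..<x} s = (1 :: complex)"
      by (rule AE_period_measure) (use 2 in \<open>auto split: split_indicator\<close>)
    then show ?thesis by (rule trig_approximable_AE_const) simp
  next
    case 3
    \<comment> \<open>Ramps from \<open>0\<close> to \<open>1\<close> of slope \<open>n\<close> that
      start at the threshold \<open>cos (pi * x / b)\<close>; they converge pointwise to the
      indicator of the open half-line above it.\<close>
    define \<phi> where "\<phi> = (\<lambda>(n::nat) y. max 0 (min 1 (real n * (y - cos (pi * x / b)))))"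
    show ?thesis
    proof (rule trig_approximable_limit[where w = "\<lambda>_. ennreal 4"
          and F = "\<lambda>n s. of_real (\<phi> n (cos (2 * pi * s / b - pi * x / b)))"])
      show "trig_approximable b (\<lambda>s. of_real (\<phi> n (cos (2 * pi * s / b - pi * x / b))))" for n
        by (rule trig_approximable_continuous_cos) (auto simp: \<phi>_def b intro!: continuous_intros)
      have "cmod (indicator {..<x} s - of_real (\<phi> n y)) \<le> 2" for s n y
      proof -
        have "cmod (indicator {..<x} s - of_real (\<phi> n y)) \<le> cmod (indicator {..<x} s) + cmod (of_real (\<phi> n y))"
          by (rule norm_triangle_ineq4)
        also have "\<dots> \<le> 1 + 1" by (intro add_mono) (auto simp: \<phi>_def split: split_indicator)
        finally show ?thesis by simp
      qed
      then have "(cmod (indicator {..<x} s - of_real (\<phi> n y)))\<^sup>2 \<le> 2\<^sup>2" for s n y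
        by (intro power_mono) auto
      then
      show "AE s in period_measure b. ennreal ((cmod (indicator {..<x} s - of_real (\<phi> n (cos (2 * pi * s / b - pi * x / b)))))\<^sup>2) \<le> ennreal 4" for n
        by (intro AE_I2 ennreal_leI) simp
      show "AE s in period_measure b. (\<lambda>n. complex_of_real (\<phi> n (cos (2 * pi * s / b - pi * x / b)))) \<longlonglongrightarrow> indicator {..<x} s"
      proof (rule AE_period_measure)
        show "AE s in lborel. s \<in> {0..<b} \<longrightarrow> (\<lambda>n. complex_of_real (\<phi> n (cos (2 * pi * s / b - pi * x / b)))) \<longlonglongrightarrow> indicator {..<x} s"
          \<comment> \<open>At \<open>s = 0\<close> the cosine equals the threshold and the ramps
            vanish although \<open>0 < x\<close>; this null point is discarded.\<close>
          using AE_lborel_singleton[of 0]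
        proof (eventually_elim, intro impI)
          fix s :: real assume s: "s \<noteq> 0" "s \<in> {0..<b}"
          define y where "y = cos (2 * pi * s / b - pi * x / b)"
          have iff: "y > cos (pi * x / b) \<longleftrightarrow> s < x"
            unfolding y_def using 3 s by (intro cos_gt_iff_arc) auto
          have "(\<lambda>n. \<phi> n y) \<longlonglongrightarrow> indicator {..<x} s"
          proof (cases "s < x")
            case True
            then have pos: "y - cos (pi * x / b) > 0" using iff by simp
            obtain n0 :: nat where n0: "1 / (y - cos (pi * x / b)) < real n0" using reals_Archimedean2 by blast
            have "\<phi> n y = 1" if "n \<ge> n0" for n
            proof -
              have "1 / (y - cos (pi * x / b)) < real n" using n0 that by linarith
              then have "1 < real n * (y - cos (pi * x / b))" using pos by (simp add: field_simps)
              then show ?thesis by (simp add: \<phi>_def)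
            qed
            then have "eventually (\<lambda>n. \<phi> n y = 1) sequentially" by (auto simp: eventually_sequentially)
            then show ?thesis using True by (auto intro: tendsto_eventually)
          next
            case False
            then have "y - cos (pi * x / b) \<le> 0" using iff by simp
            then have le0: "real n * (y - cos (pi * x / b)) \<le> 0" for n by (simp add: mult_le_0_iff)
            have "\<phi> n y = 0" for n using le0[of n] unfolding \<phi>_def by linarith
            then show ?thesis using False by simp
          qed
          then have "(\<lambda>n. complex_of_real (\<phi> n y)) \<longlonglongrightarrow> of_real (indicator {..<x} s)"
            by (rule tendsto_of_real)
          then show "(\<lambda>n. complex_of_real (\<phi> n (cos (2 * pi * s / b - pi * x / b)))) \<longlonglongrightarrow> indicator {..<x} s"
            by (simp add: y_def indicator_def of_bool_def split: if_splits)
        qed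
      qed
      show "(\<integral>\<^sup>+s. ennreal 4 \<partial>period_measure b) < \<infinity>"
        by (rule nn_integral_period_measure_const_finite[OF b])
    qed measurable
  qed
qed

text \<open>A Dynkin argument: half-lines form an intersection-stable generator, and approximability
  passes to complements and, by dominated convergence, to disjoint countable unions.\<close>

lemma trig_approximable_indicator:
  assumes b: "b > 0" and A: "A \<in> sets borel"
  shows "trig_approximable b (indicator A)"
proof -
  have A: "A \<in> sigma_sets UNIV (range lessThan)"
    using A by (subst (asm) borel_Iio) simp
  have Int: "Int_stable (range (lessThan :: real \<Rightarrow> _))"
    unfolding Int_stable_def
  proof safe
    fix x y :: real
    have "{..<x} \<inter> {..<y} = {..<min x y}" by auto
    then show "{..<x} \<inter> {..<y} \<in> range lessThan" by simp
  qed
  have meas: "sigma_sets UNIV (range lessThan) = sets (borel :: real measure)"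
    by (subst borel_Iio) simp
  have sub: "range (lessThan :: real \<Rightarrow> _) \<subseteq> Pow UNIV" by simp
  from Int sub A show ?thesis
  proof (induction rule: sigma_sets_induct_disjoint)
    case (basic A)
    then show ?case using trig_approximable_lessThan[OF b] by auto
  next
    case empty
    then show ?case
      using trig_approximable_trig_poly[OF trig_poly_const[of b 0]] by (simp add: indicator_def[abs_def])
  next
    case (compl A)
    have "trig_approximable b (\<lambda>s. 1 + (- 1) * indicator A s)"
      by (intro trig_approximable_add trig_approximable_cmult compl trig_approximable_trig_poly trig_poly_const)
    moreover have "(\<lambda>s. 1 + (- 1) * indicator A s) = (indicator (UNIV - A) :: real \<Rightarrow> complex)"
      by (auto split: split_indicator)
    ultimately show ?case by simp
  next
    case (union A)
    have [measurable]: "A i \<in> sets borel" for i using union meas by auto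
    show ?case
    proof (rule trig_approximable_limit[where w = "\<lambda>_. ennreal 1" and F = "\<lambda>n. indicator (\<Union>i<n. A i)"])
      show "trig_approximable b (indicator (\<Union>i<n. A i))" for n
      proof -
        have "disjoint_family_on A {..<n}"
          using union(1) by (auto simp: disjoint_family_on_def)
        then have "(indicator (\<Union>i<n. A i) :: real \<Rightarrow> complex) = (\<lambda>s. \<Sum>i<n. indicator (A i) s)"
          by (intro ext indicator_UN_disjoint) auto
        then show ?thesis using union(3) by (simp add: trig_approximable_sum)
      qed
      show "AE s in period_measure b. ennreal ((cmod (indicator (\<Union>i. A i) s - indicator (\<Union>i<n. A i) s))\<^sup>2) \<le> ennreal 1" for n
      proof (intro AE_I2 ennreal_leI)
        fix s
        show "(cmod (indicator (\<Union>i. A i) s - indicator (\<Union>i<n. A i) s))\<^sup>2 \<le> 1"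
          by (cases "s \<in> (\<Union>i. A i)"; cases "s \<in> (\<Union>i<n. A i)") (simp_all add: indicator_def del: UN_iff)
      qed
      show "AE s in period_measure b. (\<lambda>n. indicator (\<Union>i<n. A i) s) \<longlonglongrightarrow> (indicator (\<Union>i. A i) s :: complex)"
        by (intro AE_I2 LIMSEQ_indicator_UN)
      show "(\<integral>\<^sup>+s. ennreal 1 \<partial>period_measure b) < \<infinity>"
        by (rule nn_integral_period_measure_const_finite[OF b])
    qed measurable
  qed
qed

text \<open>Simple functions are combinations of indicators, and a sequence of them bounded by
  \<open>2 * cmod (f s)\<close> converges to \<open>f\<close> in square mean. The constant
  \<open>10\<close> in the dominating function is \<open>2 + 2 * 2^2\<close>.\<close>

lemma trig_approximable_L2:
  assumes b: "b > 0" and [measurable]: "f \<in> borel_measurable borel"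
    and fin: "(\<integral>\<^sup>+s. ennreal ((cmod (f s))\<^sup>2) \<partial>period_measure b) < \<infinity>"
  shows "trig_approximable b f"
proof -
  obtain F where F: "\<And>i. simple_function borel (F i)" "\<And>x. (\<lambda>i::nat. F i x) \<longlonglongrightarrow> f x"
    "\<And>i x. cmod (F i x) \<le> 2 * cmod (f x)"
    using borel_measurable_implies_sequence_metric[of f borel 0] by auto
  show ?thesis
  proof (rule trig_approximable_limit[where F = F and w = "\<lambda>s. 10 * ennreal ((cmod (f s))\<^sup>2)"])
    show "trig_approximable b (F i)" for i
    proof -
      have fin: "finite (range (F i))" using F(1)[of i] by (auto simp: simple_function_def)
      have "F i = (\<lambda>s. \<Sum>y\<in>range (F i). y * indicator (F i -` {y}) s)"
      proof
        fix s
        have "(\<Sum>y\<in>range (F i). y * indicator (F i -` {y}) s) = (\<Sum>y\<in>range (F i). if F i s = y then y else 0)"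
          by (intro sum.cong) (auto split: split_indicator)
        also have "\<dots> = F i s" using fin by (simp add: sum.delta')
        finally show "F i s = (\<Sum>y\<in>range (F i). y * indicator (F i -` {y}) s)" ..
      qed
      moreover have "trig_approximable b (\<lambda>s. \<Sum>y\<in>range (F i). y * indicator (F i -` {y}) s)"
        using F(1)[of i] b
        by (intro trig_approximable_sum trig_approximable_cmult trig_approximable_indicator)
          (auto simp: simple_function_def)
      ultimately show ?thesis by simp
    qed
    show "AE s in period_measure b. ennreal ((cmod (f s - F n s))\<^sup>2) \<le> 10 * ennreal ((cmod (f s))\<^sup>2)" for n
    proof (rule AE_I2)
      fix s
      have "(cmod (f s + - F n s))\<^sup>2 \<le> 2 * (cmod (f s))\<^sup>2 + 2 * (cmod (- F n s))\<^sup>2"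
        by (rule cmod_add_square_le)
      also have "(cmod (- F n s))\<^sup>2 \<le> (2 * cmod (f s))\<^sup>2"
        using F(3)[of n s] by (intro power_mono) auto
      finally have "(cmod (f s - F n s))\<^sup>2 \<le> 10 * (cmod (f s))\<^sup>2"
        by (simp add: power_mult_distrib)
      then have "ennreal ((cmod (f s - F n s))\<^sup>2) \<le> ennreal (10 * (cmod (f s))\<^sup>2)"
        by (rule ennreal_leI)
      then show "ennreal ((cmod (f s - F n s))\<^sup>2) \<le> 10 * ennreal ((cmod (f s))\<^sup>2)"
        by (simp add: ennreal_mult)
    qed
    show "(\<integral>\<^sup>+s. 10 * ennreal ((cmod (f s))\<^sup>2) \<partial>period_measure b) < \<infinity>"
      using fin by (simp add: nn_integral_cmult ennreal_mult_less_top)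
    show "f \<in> borel_measurable borel" by measurable
    show "(\<lambda>s. 10 * ennreal ((cmod (f s))\<^sup>2)) \<in> borel_measurable borel" by measurable
    show "AE s in period_measure b. (\<lambda>n. F n s) \<longlonglongrightarrow> f s" using F(2) by simp
  qed
qed

subsection \<open>Parseval's identity and periodization\<close>

lemma cmod_le_one_plus_square: "cmod z \<le> 1 + (cmod z)\<^sup>2"
proof -
  have "0 \<le> (cmod z - 1)\<^sup>2" by simp
  then have "2 * cmod z \<le> 1 + (cmod z)\<^sup>2" by (simp add: power2_diff)
  then show ?thesis using norm_ge_zero[of z] by linarith
qed

lemma integrable_of_square_integrable_period_measure:
  fixes G :: "real \<Rightarrow> complex"
  assumes b: "b \<ge> 0" and [measurable]: "G \<in> borel_measurable borel"
    and sq: "integrable (period_measure b) (\<lambda>s. (cmod (G s))\<^sup>2)"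
  shows "integrable (period_measure b) G"
proof (rule Bochner_Integration.integrable_bound)
  interpret finite_measure "period_measure b" by (rule finite_measure_period_measure[OF b])
  show "integrable (period_measure b) (\<lambda>s. 1 + (cmod (G s))\<^sup>2)"
    using sq by simp
  show "AE s in period_measure b. norm (G s) \<le> norm (1 + (cmod (G s))\<^sup>2)"
    using cmod_le_one_plus_square by simp
qed measurable

text \<open>Expand the square and use the orthogonality of the characters; completing the square
  isolates the only term that depends on \<open>z\<close>. It vanishes at
  \<open>z n = c n / b\<close>, which gives Bessel's inequality, and is nonnegative otherwise, which
  is the best-approximation property.\<close>

lemma integral_cmod_square_diff_trig:
  fixes G :: "real \<Rightarrow> complex"
  assumes b: "b > 0" and G [measurable]: "G \<in> borel_measurable borel"
    and sq: "integrable (period_measure b) (\<lambda>s. (cmod (G s))\<^sup>2)"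
    and S: "finite S" and c: "\<And>n. c n = (\<integral>s. G s * character b (- n) s \<partial>period_measure b)"
  shows "has_bochner_integral (period_measure b) (\<lambda>s. (cmod (G s - (\<Sum>n\<in>S. z n * character b n s)))\<^sup>2)
    ((\<integral>s. (cmod (G s))\<^sup>2 \<partial>period_measure b) - (\<Sum>n\<in>S. (cmod (c n))\<^sup>2) / b
      + b * (\<Sum>n\<in>S. (cmod (z n - c n / b))\<^sup>2))"
proof -
  interpret finite_measure "period_measure b"
    by (rule finite_measure_period_measure) (use b in simp)
  have intG: "integrable (period_measure b) G"
    using b by (intro integrable_of_square_integrable_period_measure sq G) simp
  have cint: "has_bochner_integral (period_measure b) (\<lambda>s. G s * character b (- n) s) (c n)" for n
    unfolding c
  proof (rule has_bochner_integral_integrable, rule Bochner_Integration.integrable_bound[OF intG])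
    show "AE s in period_measure b. norm (G s * character b (- n) s) \<le> norm (G s)"
      by (simp add: norm_mult)
  qed measurable
  have cint': "has_bochner_integral (period_measure b) (\<lambda>s. cnj (G s * character b (- n) s)) (cnj (c n))" for n
    by (rule has_bochner_integral_bounded_linear[OF bounded_linear_cnj cint])
  have chint: "has_bochner_integral (period_measure b) (character b n) (if n = 0 then of_real b else 0)" for n
    unfolding has_bochner_integral_iff
  proof
    show "integrable (period_measure b) (character b n)"
      by (rule integrable_const_bound[of _ 1]) auto
  qed (rule integral_character[OF b])
  have "has_bochner_integral (period_measure b) (\<lambda>s. complex_of_real ((cmod (G s))\<^sup>2))
      (of_real (\<integral>s. (cmod (G s))\<^sup>2 \<partial>period_measure b))"
    by (rule has_bochner_integral_bounded_linear[OF bounded_linear_of_real has_bochner_integral_integrable[OF sq]])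
  \<comment> \<open>The expansion is integrated with complex values, where conjugates multiply out;
    the real part is taken at the end.\<close>
  then have "has_bochner_integral (period_measure b)
     (\<lambda>s. complex_of_real ((cmod (G s))\<^sup>2) - (\<Sum>n\<in>S. cnj (z n) * (G s * character b (- n) s))
        - (\<Sum>n\<in>S. z n * cnj (G s * character b (- n) s))
        + (\<Sum>n\<in>S. \<Sum>m\<in>S. (z n * cnj (z m)) * character b (n - m) s))
     (of_real (\<integral>s. (cmod (G s))\<^sup>2 \<partial>period_measure b) - (\<Sum>n\<in>S. cnj (z n) * c n) - (\<Sum>n\<in>S. z n * cnj (c n))
        + (\<Sum>n\<in>S. \<Sum>m\<in>S. (z n * cnj (z m)) * (if n - m = 0 then of_real b else 0)))"
    by (intro has_bochner_integral_add has_bochner_integral_diff has_bochner_integral_sum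
        has_bochner_integral_mult_right cint cint' chint)
  moreover have "complex_of_real ((cmod (G s))\<^sup>2) - (\<Sum>n\<in>S. cnj (z n) * (G s * character b (- n) s))
        - (\<Sum>n\<in>S. z n * cnj (G s * character b (- n) s))
        + (\<Sum>n\<in>S. \<Sum>m\<in>S. (z n * cnj (z m)) * character b (n - m) s)
      = of_real ((cmod (G s - (\<Sum>n\<in>S. z n * character b n s)))\<^sup>2)" for s
  proof -
    have dbl: "(\<Sum>n\<in>S. \<Sum>m\<in>S. (z n * cnj (z m)) * character b (n - m) s)
      = (\<Sum>n\<in>S. z n * character b n s) * cnj (\<Sum>n\<in>S. z n * character b n s)"
    proof -
      have "character b (n - m) s = character b n s * character b (- m) s" for n m
        by (simp add: character_mult)
      then show ?thesis by (simp add: sum_product cnj_character mult_ac)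
    qed
    show ?thesis
      unfolding dbl complex_norm_square
      by (simp add: cnj_character algebra_simps sum_distrib_left)
  qed
  moreover have "of_real (\<integral>s. (cmod (G s))\<^sup>2 \<partial>period_measure b) - (\<Sum>n\<in>S. cnj (z n) * c n) - (\<Sum>n\<in>S. z n * cnj (c n))
        + (\<Sum>n\<in>S. \<Sum>m\<in>S. (z n * cnj (z m)) * (if n - m = 0 then of_real b else 0))
    = of_real ((\<integral>s. (cmod (G s))\<^sup>2 \<partial>period_measure b) - (\<Sum>n\<in>S. (cmod (c n))\<^sup>2) / b
      + b * (\<Sum>n\<in>S. (cmod (z n - c n / b))\<^sup>2))"
  proof -
    have "(\<Sum>n\<in>S. \<Sum>m\<in>S. (z n * cnj (z m)) * (if n - m = 0 then of_real b else 0))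
      = (\<Sum>n\<in>S. of_real b * (z n * cnj (z n)))"
    proof (rule sum.cong)
      fix n assume "n \<in> S"
      have "(\<Sum>m\<in>S. (z n * cnj (z m)) * (if n - m = 0 then complex_of_real b else 0))
        = (\<Sum>m\<in>S. if n = m then of_real b * (z n * cnj (z m)) else 0)"
        by (intro sum.cong) auto
      also have "\<dots> = of_real b * (z n * cnj (z n))"
        using S \<open>n \<in> S\<close> by simp
      finally show "(\<Sum>m\<in>S. (z n * cnj (z m)) * (if n - m = 0 then complex_of_real b else 0)) = of_real b * (z n * cnj (z n))" .
    qed simp
    moreover have "complex_of_real (b * (cmod (z n - c n / b))\<^sup>2) =
      of_real b * (z n * cnj (z n)) - cnj (z n) * c n - z n * cnj (c n) + of_real ((cmod (c n))\<^sup>2 / b)" for n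
      using b unfolding of_real_mult of_real_divide complex_norm_square by (simp add: field_simps)
    ultimately show ?thesis
      by (simp add: sum_distrib_left sum_subtractf sum.distrib sum_divide_distrib)
  qed
  ultimately have "has_bochner_integral (period_measure b)
      (\<lambda>s. complex_of_real ((cmod (G s - (\<Sum>n\<in>S. z n * character b n s)))\<^sup>2))
      (of_real ((\<integral>s. (cmod (G s))\<^sup>2 \<partial>period_measure b) - (\<Sum>n\<in>S. (cmod (c n))\<^sup>2) / b
      + b * (\<Sum>n\<in>S. (cmod (z n - c n / b))\<^sup>2)))"
    by (simp only:)
  from has_bochner_integral_bounded_linear[OF bounded_linear_Re this] show ?thesis
    by simp
qed

text \<open>Bessel's inequality bounds the sum from above. Density of the trigonometric polynomials
  bounds it from below, since any approximant errs at least as much as the Fourier partial sum on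
  the same frequencies.\<close>

theorem parseval_period_measure:
  fixes G :: "real \<Rightarrow> complex"
  assumes b: "b > 0" and G [measurable]: "G \<in> borel_measurable borel"
    and sq: "integrable (period_measure b) (\<lambda>s. (cmod (G s))\<^sup>2)"
  shows "((\<lambda>n. (cmod (\<integral>s. G s * character b n s \<partial>period_measure b))\<^sup>2)
    has_sum (b * (\<integral>s. (cmod (G s))\<^sup>2 \<partial>period_measure b))) UNIV"
proof -
  define E where "E = (\<integral>s. (cmod (G s))\<^sup>2 \<partial>period_measure b)"
  define c where "c = (\<lambda>n. \<integral>s. G s * character b (- n) s \<partial>period_measure b)"
  define g where "g = (\<lambda>n. (cmod (c n))\<^sup>2)"
  have "c n = (\<integral>s. G s * character b (- n) s \<partial>period_measure b)" for n by (simp add: c_def)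
  note id = integral_cmod_square_diff_trig[OF b G sq _ this, folded E_def]
  have bessel: "sum g S \<le> b * E" if "finite S" for S
  proof -
    have "0 \<le> (\<integral>s. (cmod (G s - (\<Sum>n\<in>S. (c n / b) * character b n s)))\<^sup>2 \<partial>period_measure b)"
      by simp
    also have "\<dots> = E - sum g S / b"
      using has_bochner_integral_integral_eq[OF id[OF that, of "\<lambda>n. c n / b"]] by (simp add: g_def)
    finally show ?thesis using b by (simp add: field_simps)
  qed
  have "g summable_on UNIV"
    by (rule nonneg_bdd_above_summable_on) (auto simp: g_def[symmetric] bdd_above_def intro!: bessel, auto simp: g_def)
  moreover have "infsum g UNIV = b * E"
  proof (rule antisym)
    show "infsum g UNIV \<le> b * E"
      by (rule infsum_le_finite_sums) (use \<open>g summable_on UNIV\<close> bessel in auto)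
    show "b * E \<le> infsum g UNIV"
    proof (rule field_le_epsilon)
      fix e :: real assume e: "e > 0"
      have "(\<integral>\<^sup>+s. ennreal ((cmod (G s))\<^sup>2) \<partial>period_measure b) < \<infinity>"
        using sq by (simp add: nn_integral_eq_integral)
      then have "trig_approximable b G" by (intro trig_approximable_L2 b G)
      then obtain P where P: "trig_poly b P"
        "(\<integral>\<^sup>+s. ennreal ((cmod (G s - P s))\<^sup>2) \<partial>period_measure b) < ennreal (e / b)"
        unfolding trig_approximable_def using e b by (meson divide_pos_pos)
      obtain S z where S: "finite S" and Pz: "P = (\<lambda>s. \<Sum>n\<in>S. z n * character b n s)"
        using trig_poly_expansion[OF P(1)] .
      note id' = id[OF S, of z, folded fun_cong[OF Pz]]
      have "ennreal (\<integral>s. (cmod (G s - P s))\<^sup>2 \<partial>period_measure b) < ennreal (e / b)"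
        using P(2) id' by (subst nn_integral_eq_integral[symmetric]) (auto simp: has_bochner_integral_iff)
      then have "(\<integral>s. (cmod (G s - P s))\<^sup>2 \<partial>period_measure b) < e / b"
        by (simp add: ennreal_less_iff)
      then have "E - sum g S / b + b * (\<Sum>n\<in>S. (cmod (z n - c n / b))\<^sup>2) < e / b"
        using has_bochner_integral_integral_eq[OF id'] by (simp add: g_def)
      moreover have "0 \<le> b * (\<Sum>n\<in>S. (cmod (z n - c n / b))\<^sup>2)"
        using b by (intro mult_nonneg_nonneg sum_nonneg) auto
      ultimately have "E - sum g S / b < e / b" by linarith
      then have "b * E < sum g S + e" using mult_strict_left_mono[OF _ b, of "E - sum g S / b" "e / b"] b
        by (simp add: right_diff_distrib)
      moreover have "sum g S \<le> infsum g UNIV"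
        by (rule finite_sum_le_infsum) (use \<open>g summable_on UNIV\<close> S in \<open>auto simp: g_def\<close>)
      ultimately show "b * E \<le> infsum g UNIV + e" by linarith
    qed
  qed
  ultimately have "(g has_sum (b * E)) UNIV" by (metis has_sum_infsum)
  \<comment> \<open>The coefficients \<open>c n\<close> were taken against
    \<open>character b (- n)\<close>; reflecting the index restores the stated sign.\<close>
  moreover have "bij_betw uminus (UNIV :: int set) UNIV"
    by (rule bij_betwI[of _ _ _ uminus]) auto
  ultimately have "((\<lambda>n. g (- n)) has_sum (b * E)) UNIV"
    by (simp add: has_sum_reindex_bij_betw)
  then show ?thesis by (simp add: g_def c_def E_def)
qed

section \<open>Folding integrals over the line into one period\<close>

lemma floor_divide_eq_iff_tile:
  fixes u b :: real
  assumes "b > 0"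
  shows "u \<in> {of_int i * b..<(of_int i + 1) * b} \<longleftrightarrow> \<lfloor>u / b\<rfloor> = i"
  using assms by (auto simp: floor_eq_iff field_simps)

lemma sum_indicator_tiles:
  fixes b :: real
  assumes "b > 0"
  shows "(\<Sum>i\<in>{p..<q}. indicator {of_int i * b..<(of_int i + 1) * b} u)
    = (indicator {of_int p * b..<of_int q * b} u :: 'a::{comm_semiring_1})"
proof -
  have "(\<Sum>i\<in>{p..<q}. indicator {of_int i * b..<(of_int i + 1) * b} u)
    = (\<Sum>i\<in>{p..<q}. if \<lfloor>u / b\<rfloor> = i then 1 else 0 :: 'a)"
    unfolding indicator_def floor_divide_eq_iff_tile[OF assms] by (simp add: of_bool_def)
  also have "\<dots> = (if \<lfloor>u / b\<rfloor> \<in> {p..<q} then 1 else 0)" by simp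
  also have "\<lfloor>u / b\<rfloor> \<in> {p..<q} \<longleftrightarrow> u \<in> {of_int p * b..<of_int q * b}"
    using assms by (auto simp: le_floor_iff floor_less_iff field_simps)
  finally show ?thesis by (simp add: indicator_def)
qed

lemma nn_integral_tile:
  assumes [measurable]: "h \<in> borel_measurable borel"
  shows "(\<integral>\<^sup>+s. h (s + of_int i * b) \<partial>period_measure b)
    = (\<integral>\<^sup>+u. h u * indicator {of_int i * b..<(of_int i + 1) * b} u \<partial>lborel)"
proof -
  have "(\<integral>\<^sup>+u. h u * indicator {of_int i * b..<(of_int i + 1) * b} u \<partial>lborel)
    = (\<integral>\<^sup>+s. h (of_int i * b + 1 * s) * indicator {of_int i * b..<(of_int i + 1) * b} (of_int i * b + 1 * s) \<partial>lborel)"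
    by (subst nn_integral_real_affine[where c = 1 and t = "of_int i * b"]) auto
  also have "\<dots> = (\<integral>\<^sup>+s. h (s + of_int i * b) * indicator {0..<b} s \<partial>lborel)"
    by (intro nn_integral_cong) (auto simp: algebra_simps split: split_indicator)
  finally show ?thesis by (simp add: nn_integral_period_measure)
qed

lemma nn_integral_tiles:
  assumes b: "b > 0" and [measurable]: "h \<in> borel_measurable borel"
  shows "(\<integral>\<^sup>+s. (\<Sum>i\<in>{p..<q}. h (s + of_int i * b)) \<partial>period_measure b)
    = (\<integral>\<^sup>+u. h u * indicator {of_int p * b..<of_int q * b} u \<partial>lborel)"
proof -
  have "(\<integral>\<^sup>+s. (\<Sum>i\<in>{p..<q}. h (s + of_int i * b)) \<partial>period_measure b)
    = (\<Sum>i\<in>{p..<q}. \<integral>\<^sup>+u. h u * indicator {of_int i * b..<(of_int i + 1) * b} u \<partial>lborel)"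
    by (subst nn_integral_sum) (auto simp: nn_integral_tile)
  also have "\<dots> = (\<integral>\<^sup>+u. h u * (\<Sum>i\<in>{p..<q}. indicator {of_int i * b..<(of_int i + 1) * b} u) \<partial>lborel)"
    by (subst nn_integral_sum[symmetric]) (auto simp: sum_distrib_left)
  finally show ?thesis by (simp add: sum_indicator_tiles[OF b])
qed

lemma has_bochner_integral_tile:
  fixes H :: "real \<Rightarrow> complex"
  assumes H: "integrable lborel H"
  shows "has_bochner_integral (period_measure b) (\<lambda>s. H (s + of_int i * b))
    (\<integral>u. indicator {of_int i * b..<(of_int i + 1) * b} u *\<^sub>R H u \<partial>lborel)"
proof -
  have [measurable]: "H \<in> borel_measurable borel" using borel_measurable_integrable[OF H] by simp
  have "integrable lborel (\<lambda>u. indicator {of_int i * b..<(of_int i + 1) * b} u *\<^sub>R H u)"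
    by (rule integrable_mult_indicator[OF _ H]) simp
  then have "has_bochner_integral lborel (\<lambda>u. indicator {of_int i * b..<(of_int i + 1) * b} u *\<^sub>R H u)
    (\<integral>u. indicator {of_int i * b..<(of_int i + 1) * b} u *\<^sub>R H u \<partial>lborel)"
    by (rule has_bochner_integral_integrable)
  then have "has_bochner_integral lborel (\<lambda>s. indicator {of_int i * b..<(of_int i + 1) * b} (of_int i * b + 1 * s) *\<^sub>R H (of_int i * b + 1 * s))
    (\<integral>u. indicator {of_int i * b..<(of_int i + 1) * b} u *\<^sub>R H u \<partial>lborel)"
    by (subst (asm) lborel_has_bochner_integral_real_affine_iff[where c = 1 and t = "of_int i * b"]) auto
  also have "(\<lambda>s. indicator {of_int i * b..<(of_int i + 1) * b} (of_int i * b + 1 * s) *\<^sub>R H (of_int i * b + 1 * s))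
    = (\<lambda>s. indicator {0..<b} s *\<^sub>R H (s + of_int i * b))"
    by (auto simp: algebra_simps split: split_indicator)
  finally show ?thesis
    unfolding period_measure_def by (intro has_bochner_integral_density) auto
qed

subsection \<open>Fibers of the frame operator\<close>

text \<open>Row \<open>m\<close> of the Ron-Shen matrix applied to the samples of \<open>f\<close>
  on a coset. For \<open>s\<close> in \<open>[0, b)\<close> the index range contains every
  \<open>i\<close> with \<open>s + i b\<close> in \<open>[0, c)\<close>, so this is the
  \<open>b\<close>-periodization of \<open>f\<close> cut to \<open>[m a, m a + c)\<close>, viewed
  from \<open>m a\<close>.\<close>

definition fiber :: "real \<Rightarrow> real \<Rightarrow> real \<Rightarrow> (real \<Rightarrow> complex) \<Rightarrow> int \<Rightarrow> real \<Rightarrow> complex" where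
  "fiber a b c f m s =
     (\<Sum>i\<in>{0..<\<lfloor>c / b\<rfloor> + 1}. indicator {0..<c} (s + of_int i * b) * f (of_int m * a + (s + of_int i * b)))"

definition fiber_energy :: "real \<Rightarrow> real \<Rightarrow> real \<Rightarrow> (real \<Rightarrow> complex) \<Rightarrow> int \<Rightarrow> real" where
  "fiber_energy a b c f m = (\<integral>s. (cmod (fiber a b c f m s))\<^sup>2 \<partial>period_measure b)"

lemma L2_measurable: "L2 f \<Longrightarrow> f \<in> borel_measurable borel"
  by (simp add: L2_def)

lemma fiber_measurable:
  assumes [measurable]: "f \<in> borel_measurable borel"
  shows "fiber a b c f m \<in> borel_measurable borel"
  unfolding fiber_def[abs_def] by measurable

lemma L2_normsq_eq_nn_integral:
  "L2 f \<Longrightarrow> ennreal (L2_normsq f) = (\<integral>\<^sup>+t. ennreal ((cmod (f t))\<^sup>2) \<partial>lborel)"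
  by (simp add: L2_def L2_normsq_def nn_integral_eq_integral)

text \<open>On a window of finite length, \<open>cmod z <= 1 + (cmod z)^2\<close> turns square
  integrability into integrability.\<close>

lemma integrable_window:
  assumes f: "L2 f"
  shows "integrable lborel (\<lambda>u. indicator {0..<c} u * f (x + u))"
proof (rule Bochner_Integration.integrable_bound)
  have [measurable]: "f \<in> borel_measurable borel" using f by (rule L2_measurable)
  have "integrable lborel (\<lambda>u. (cmod (f (x + 1 * u)))\<^sup>2)"
    by (rule lborel_integrable_real_affine) (use f in \<open>auto simp: L2_def\<close>)
  moreover have "integrable lborel (indicator {0..<c} :: real \<Rightarrow> real)"
    by (rule integrable_real_indicator) (cases "0 \<le> c"; simp)+
  ultimately show "integrable lborel (\<lambda>u. indicator {0..<c} u + (cmod (f (x + u)))\<^sup>2)"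
    by simp
  show "AE u in lborel. norm (indicator {0..<c} u * f (x + u)) \<le> norm (indicator {0..<c} u + (cmod (f (x + u)))\<^sup>2)"
    using cmod_le_one_plus_square by (auto split: split_indicator)
  show "(\<lambda>u. indicator {0..<c} u * f (x + u)) \<in> borel_measurable lborel" by measurable
qed

lemma cnj_gabor_atom_indicator:
  "cnj (gabor_atom (\<lambda>t. indicator {0..<c} t) a b m n t) = character b n t * indicator {0..<c} (t - of_int m * a)"
proof -
  have "- 2 * complex_of_real pi * \<i> * of_int n * complex_of_real t / complex_of_real b
    = \<i> * of_real (2 * pi * of_int (- n) * t / b)" by simp
  then have "exp (- 2 * complex_of_real pi * \<i> * of_int n * complex_of_real t / complex_of_real b) = character b (- n) t"
    unfolding character_def cis_conv_exp by metis
  then show ?thesis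
    by (simp add: gabor_atom_def cnj_character split: split_indicator)
qed

text \<open>Folding the window onto \<open>[0, b)\<close> leaves the character unchanged, so a Gabor
  coefficient is a Fourier coefficient of the row; recentring at \<open>m a\<close> only costs a
  unimodular factor.\<close>

lemma cmod_L2_inner_gabor_atom:
  assumes b: "b > 0" and f: "L2 f"
  shows "cmod (L2_inner f (gabor_atom (\<lambda>t. indicator {0..<c} t) a b m n))
    = cmod (\<integral>s. fiber a b c f m s * character b n s \<partial>period_measure b)"
proof -
  have [measurable]: "f \<in> borel_measurable borel" using f by (rule L2_measurable)
  define h where "h = (\<lambda>u. indicator {0..<c} u * f (of_int m * a + u))"
  define H where "H = (\<lambda>u. h u * character b n u)"
  define I where "I = {0..<\<lfloor>c / b\<rfloor> + 1}"
  have H: "integrable lborel H"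
  proof (rule Bochner_Integration.integrable_bound)
    show "integrable lborel h" unfolding h_def by (rule integrable_window[OF f])
    show "AE u in lborel. norm (H u) \<le> norm (h u)" by (simp add: H_def norm_mult)
    show "H \<in> borel_measurable lborel" unfolding H_def h_def by measurable
  qed
  have "L2_inner f (gabor_atom (\<lambda>t. indicator {0..<c} t) a b m n)
    = (\<integral>t. f t * (character b n t * indicator {0..<c} (t - of_int m * a)) \<partial>lborel)"
    unfolding L2_inner_def cnj_gabor_atom_indicator ..
  also have "\<dots> = (\<integral>u. f (of_int m * a + 1 * u) * (character b n (of_int m * a + 1 * u) * indicator {0..<c} (of_int m * a + 1 * u - of_int m * a)) \<partial>lborel)"
    by (subst lborel_integral_real_affine[where c = 1 and t = "of_int m * a"]) auto
  also have "\<dots> = (\<integral>u. character b n (of_int m * a) * H u \<partial>lborel)"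
    by (intro Bochner_Integration.integral_cong) (auto simp: H_def h_def character_add)
  also have "\<dots> = character b n (of_int m * a) * (\<integral>u. H u \<partial>lborel)"
    by simp
  finally have 1: "cmod (L2_inner f (gabor_atom (\<lambda>t. indicator {0..<c} t) a b m n)) = cmod (\<integral>u. H u \<partial>lborel)"
    by (simp add: norm_mult)
  have "H = (\<lambda>u. \<Sum>i\<in>I. indicator {of_int i * b..<(of_int i + 1) * b} u *\<^sub>R H u)"
  proof
    fix u
    \<comment> \<open>The tiles with index from \<open>0\<close> to the integer part of
      \<open>c / b\<close> cover the whole window.\<close>
    have "c < (of_int \<lfloor>c / b\<rfloor> + 1) * b"
      using b floor_correct[of "c / b"] by (simp add: field_simps)
    then have "H u = indicator {of_int 0 * b..<of_int (\<lfloor>c / b\<rfloor> + 1) * b} u *\<^sub>R H u"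
      unfolding H_def h_def by (auto split: split_indicator)
    also have "\<dots> = (\<Sum>i\<in>I. indicator {of_int i * b..<(of_int i + 1) * b} u) *\<^sub>R H u"
      unfolding I_def by (subst sum_indicator_tiles[OF b]) simp
    finally show "H u = (\<Sum>i\<in>I. indicator {of_int i * b..<(of_int i + 1) * b} u *\<^sub>R H u)"
      by (simp add: scaleR_sum_left)
  qed
  then have "(\<integral>u. H u \<partial>lborel) = (\<integral>u. (\<Sum>i\<in>I. indicator {of_int i * b..<(of_int i + 1) * b} u *\<^sub>R H u) \<partial>lborel)"
    by metis
  also have "\<dots> = (\<Sum>i\<in>I. \<integral>u. indicator {of_int i * b..<(of_int i + 1) * b} u *\<^sub>R H u \<partial>lborel)"
    by (rule Bochner_Integration.integral_sum) (rule integrable_mult_indicator[OF _ H], simp)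
  also have "\<dots> = (\<integral>s. (\<Sum>i\<in>I. H (s + of_int i * b)) \<partial>period_measure b)"
    by (rule has_bochner_integral_integral_eq[symmetric]) (intro has_bochner_integral_sum has_bochner_integral_tile H)
  also have "\<dots> = (\<integral>s. fiber a b c f m s * character b n s \<partial>period_measure b)"
    using b by (simp add: fiber_def H_def h_def I_def character_add sum_distrib_right mult.assoc)
  finally show ?thesis using 1 by simp
qed

lemma cmod_sum_square_le: "(cmod (\<Sum>i\<in>I. x i))\<^sup>2 \<le> real (card I) * (\<Sum>i\<in>I. (cmod (x i))\<^sup>2)"
proof -
  have "(cmod (\<Sum>i\<in>I. x i))\<^sup>2 \<le> (\<Sum>i\<in>I. cmod (x i))\<^sup>2"
    by (intro power_mono norm_sum) auto
  also have "\<dots> \<le> (\<Sum>i\<in>I. (cmod (x i))\<^sup>2) * real (card I)"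
    by (rule sum_squared_le_sum_of_squares)
  finally show ?thesis by (simp add: mult.commute)
qed

text \<open>Cauchy-Schwarz over the samples of a row, followed by unfolding the period onto the
  window.\<close>

lemma nn_integral_fiber_le:
  assumes b: "b > 0" and c: "c > 0" and [measurable]: "f \<in> borel_measurable borel"
  shows "(\<integral>\<^sup>+s. ennreal ((cmod (fiber a b c f m s))\<^sup>2) \<partial>period_measure b)
    \<le> ennreal (of_int (\<lfloor>c / b\<rfloor> + 1)) *
       (\<integral>\<^sup>+t. ennreal ((cmod (f t))\<^sup>2) * indicator {of_int m * a..<of_int m * a + c} t \<partial>lborel)"
proof -
  define h where "h = (\<lambda>u. indicator {0..<c} u * f (of_int m * a + u))"
  define N where "N = \<lfloor>c / b\<rfloor> + 1"
  have N: "N \<ge> 0" using b c by (simp add: N_def)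
  have [measurable]: "h \<in> borel_measurable borel" unfolding h_def by measurable
  have fib: "fiber a b c f m s = (\<Sum>i\<in>{0..<N}. h (s + of_int i * b))" for s
    by (simp add: fiber_def h_def N_def)
  have "(\<integral>\<^sup>+s. ennreal ((cmod (fiber a b c f m s))\<^sup>2) \<partial>period_measure b)
    \<le> (\<integral>\<^sup>+s. ennreal (of_int N) * (\<Sum>i\<in>{0..<N}. ennreal ((cmod (h (s + of_int i * b)))\<^sup>2)) \<partial>period_measure b)"
  proof (rule nn_integral_mono)
    fix s
    have "(cmod (fiber a b c f m s))\<^sup>2 \<le> of_int N * (\<Sum>i\<in>{0..<N}. (cmod (h (s + of_int i * b)))\<^sup>2)"
      unfolding fib using cmod_sum_square_le[of "\<lambda>i. h (s + of_int i * b)" "{0..<N}"] N by simp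
    then have "ennreal ((cmod (fiber a b c f m s))\<^sup>2) \<le> ennreal (of_int N * (\<Sum>i\<in>{0..<N}. (cmod (h (s + of_int i * b)))\<^sup>2))"
      by (rule ennreal_leI)
    then show "ennreal ((cmod (fiber a b c f m s))\<^sup>2) \<le> ennreal (of_int N) * (\<Sum>i\<in>{0..<N}. ennreal ((cmod (h (s + of_int i * b)))\<^sup>2))"
      using N by (simp add: ennreal_mult sum_nonneg sum_ennreal)
  qed
  also have "\<dots> = ennreal (of_int N) * (\<integral>\<^sup>+s. (\<Sum>i\<in>{0..<N}. ennreal ((cmod (h (s + of_int i * b)))\<^sup>2)) \<partial>period_measure b)"
    by (rule nn_integral_cmult) measurable
  also have "(\<integral>\<^sup>+s. (\<Sum>i\<in>{0..<N}. ennreal ((cmod (h (s + of_int i * b)))\<^sup>2)) \<partial>period_measure b)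
    = (\<integral>\<^sup>+u. ennreal ((cmod (h u))\<^sup>2) * indicator {of_int 0 * b..<of_int N * b} u \<partial>lborel)"
    by (rule nn_integral_tiles[OF b, where h = "\<lambda>u. ennreal ((cmod (h u))\<^sup>2)"]) measurable
  also have "\<dots> \<le> (\<integral>\<^sup>+u. ennreal ((cmod (f (of_int m * a + 1 * u)))\<^sup>2) * indicator {of_int m * a..<of_int m * a + c} (of_int m * a + 1 * u) \<partial>lborel)"
    by (intro nn_integral_mono) (auto simp: h_def split: split_indicator)
  also have "\<dots> = (\<integral>\<^sup>+t. ennreal ((cmod (f t))\<^sup>2) * indicator {of_int m * a..<of_int m * a + c} t \<partial>lborel)"
    by (subst nn_integral_real_affine[where c = 1 and t = "of_int m * a"]) auto
  finally show ?thesis by (simp add: N_def mult_left_mono)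
qed

lemma nn_integral_fiber_finite:
  assumes b: "b > 0" and c: "c > 0" and f: "L2 f"
  shows "(\<integral>\<^sup>+s. ennreal ((cmod (fiber a b c f m s))\<^sup>2) \<partial>period_measure b) < \<infinity>"
proof -
  have [measurable]: "f \<in> borel_measurable borel" using f by (rule L2_measurable)
  have "(\<integral>\<^sup>+t. ennreal ((cmod (f t))\<^sup>2) * indicator {of_int m * a..<of_int m * a + c} t \<partial>lborel)
    \<le> (\<integral>\<^sup>+t. ennreal ((cmod (f t))\<^sup>2) \<partial>lborel)"
    by (intro nn_integral_mono) (auto split: split_indicator)
  also have "\<dots> < \<infinity>" using L2_normsq_eq_nn_integral[OF f, symmetric] by simp
  finally have "ennreal (of_int (\<lfloor>c / b\<rfloor> + 1)) *
       (\<integral>\<^sup>+t. ennreal ((cmod (f t))\<^sup>2) * indicator {of_int m * a..<of_int m * a + c} t \<partial>lborel) < \<infinity>"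
    by (simp add: ennreal_mult_less_top)
  with nn_integral_fiber_le[OF b c \<open>f \<in> borel_measurable borel\<close>] show ?thesis
    by (rule le_less_trans)
qed

lemma integrable_fiber_square:
  assumes "b > 0" "c > 0" "L2 f"
  shows "integrable (period_measure b) (\<lambda>s. (cmod (fiber a b c f m s))\<^sup>2)"
proof -
  have [measurable]: "fiber a b c f m \<in> borel_measurable borel"
    using assms(3) by (intro fiber_measurable L2_measurable)
  show ?thesis
    unfolding integrable_iff_bounded using nn_integral_fiber_finite[OF assms, of a m] by simp
qed

lemma ennreal_fiber_energy:
  assumes "b > 0" "c > 0" "L2 f"
  shows "ennreal (fiber_energy a b c f m) = (\<integral>\<^sup>+s. ennreal ((cmod (fiber a b c f m s))\<^sup>2) \<partial>period_measure b)"
  unfolding fiber_energy_def using integrable_fiber_square[OF assms] by (simp add: nn_integral_eq_integral)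

lemma fiber_energy_nonneg: "fiber_energy a b c f m \<ge> 0"
  by (simp add: fiber_energy_def)

section \<open>Frame sums as sums of row energies\<close>

lemma has_sum_gabor_coefficients:
  assumes "b > 0" "c > 0" "L2 f"
  shows "((\<lambda>n. (cmod (L2_inner f (gabor_atom (\<lambda>t. indicator {0..<c} t) a b m n)))\<^sup>2)
    has_sum (b * fiber_energy a b c f m)) UNIV"
  unfolding cmod_L2_inner_gabor_atom[OF assms(1,3)] fiber_energy_def
  using assms by (intro parseval_period_measure integrable_fiber_square fiber_measurable L2_measurable)

lemma card_window_shifts_le:
  assumes a: "a > 0" and c: "c \<ge> 0" and M: "finite M" "\<And>m. m \<in> M \<Longrightarrow> of_int m * a \<le> t \<and> t < of_int m * a + c"
  shows "real (card M) \<le> c / a + 1"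
proof -
  have "M \<subseteq> {\<lfloor>(t - c) / a\<rfloor> + 1..\<lfloor>t / a\<rfloor>}"
  proof
    fix m assume "m \<in> M"
    then have "of_int m * a \<le> t" "t < of_int m * a + c" using M by auto
    then have "of_int m \<le> t / a" "(t - c) / a < of_int m" using a by (auto simp: field_simps)
    then show "m \<in> {\<lfloor>(t - c) / a\<rfloor> + 1..\<lfloor>t / a\<rfloor>}"
      by (auto simp: le_floor_iff floor_less_iff add1_zle_eq)
  qed
  then have "card M \<le> nat (\<lfloor>t / a\<rfloor> - \<lfloor>(t - c) / a\<rfloor>)"
    using card_mono[of "{\<lfloor>(t - c) / a\<rfloor> + 1..\<lfloor>t / a\<rfloor>}" M] by simp
  moreover have "of_int (\<lfloor>t / a\<rfloor> - \<lfloor>(t - c) / a\<rfloor>) \<le> c / a + 1"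
    using floor_correct[of "t / a"] floor_correct[of "(t - c) / a"] by (simp add: diff_divide_distrib, linarith)
  moreover have "0 \<le> c / a + 1" using a c by simp
  ultimately show ?thesis by linarith
qed

text \<open>Every \<open>t\<close> lies in at most \<open>c / a + 1\<close> of the windows, so
  adding up the bounds for single rows gives the upper frame bound.\<close>

lemma sum_fiber_energy_le:
  assumes a: "a > 0" and b: "b > 0" and c: "c > 0" and f: "L2 f" and M: "finite M"
  shows "(\<Sum>m\<in>M. fiber_energy a b c f m) \<le> of_int (\<lfloor>c / b\<rfloor> + 1) * (c / a + 1) * L2_normsq f"
proof -
  have [measurable]: "f \<in> borel_measurable borel" using f by (rule L2_measurable)
  define N where "N = real_of_int (\<lfloor>c / b\<rfloor> + 1)"
  have N: "N \<ge> 0" using b c by (simp add: N_def)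
  have nn: "L2_normsq f \<ge> 0" by (simp add: L2_normsq_def)
  have "ennreal (\<Sum>m\<in>M. fiber_energy a b c f m) = (\<Sum>m\<in>M. ennreal (fiber_energy a b c f m))"
    by (simp add: sum_ennreal fiber_energy_nonneg)
  also have "\<dots> \<le> (\<Sum>m\<in>M. ennreal N * (\<integral>\<^sup>+t. ennreal ((cmod (f t))\<^sup>2) * indicator {of_int m * a..<of_int m * a + c} t \<partial>lborel))"
    unfolding ennreal_fiber_energy[OF b c f] N_def by (intro sum_mono nn_integral_fiber_le b c) measurable
  also have "\<dots> = ennreal N * (\<integral>\<^sup>+t. (\<Sum>m\<in>M. ennreal ((cmod (f t))\<^sup>2) * indicator {of_int m * a..<of_int m * a + c} t) \<partial>lborel)"
    by (subst nn_integral_sum) (auto simp: sum_distrib_left)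
  also have "(\<integral>\<^sup>+t. (\<Sum>m\<in>M. ennreal ((cmod (f t))\<^sup>2) * indicator {of_int m * a..<of_int m * a + c} t) \<partial>lborel)
    \<le> (\<integral>\<^sup>+t. ennreal (c / a + 1) * ennreal ((cmod (f t))\<^sup>2) \<partial>lborel)"
  proof (rule nn_integral_mono)
    fix t
    define M' where "M' = {m\<in>M. t \<in> {of_int m * a..<of_int m * a + c}}"
    have "(\<Sum>m\<in>M. ennreal ((cmod (f t))\<^sup>2) * indicator {of_int m * a..<of_int m * a + c} t)
      = (\<Sum>m\<in>M'. ennreal ((cmod (f t))\<^sup>2))"
      unfolding M'_def using M by (intro sum.mono_neutral_cong_right) (auto split: split_indicator)
    also have "\<dots> = ennreal (real (card M')) * ennreal ((cmod (f t))\<^sup>2)"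
      by (simp add: ennreal_of_nat_eq_real_of_nat)
    also have "real (card M') \<le> c / a + 1"
      by (rule card_window_shifts_le[of _ _ _ t]) (use a c M in \<open>auto simp: M'_def\<close>)
    finally show "(\<Sum>m\<in>M. ennreal ((cmod (f t))\<^sup>2) * indicator {of_int m * a..<of_int m * a + c} t)
      \<le> ennreal (c / a + 1) * ennreal ((cmod (f t))\<^sup>2)"
      by (simp add: mult_right_mono ennreal_leI)
  qed
  also have "\<dots> = ennreal (c / a + 1) * ennreal (L2_normsq f)"
    by (simp add: nn_integral_cmult L2_normsq_eq_nn_integral[OF f])
  finally have "ennreal (\<Sum>m\<in>M. fiber_energy a b c f m) \<le> ennreal N * (ennreal (c / a + 1) * ennreal (L2_normsq f))"
    by (simp add: mult_left_mono)
  also have "\<dots> = ennreal (N * ((c / a + 1) * L2_normsq f))"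
    using N a c nn by (simp add: ennreal_mult)
  finally have "(\<Sum>m\<in>M. fiber_energy a b c f m) \<le> N * ((c / a + 1) * L2_normsq f)"
    using N a c nn by (subst (asm) ennreal_le_iff) (auto intro!: mult_nonneg_nonneg add_nonneg_nonneg)
  then show ?thesis by (simp add: N_def mult.assoc)
qed

lemma summable_fiber_energy:
  assumes "a > 0" "b > 0" "c > 0" "L2 f"
  shows "fiber_energy a b c f summable_on UNIV"
  using sum_fiber_energy_le[OF assms]
  by (intro nonneg_bdd_above_summable_on) (auto simp: bdd_above_def fiber_energy_nonneg)

lemma has_sum_gabor_frame_operator:
  assumes "a > 0" "b > 0" "c > 0" "L2 f"
  shows "((\<lambda>(m,n). (cmod (L2_inner f (gabor_atom (\<lambda>t. indicator {0..<c} t) a b m n)))\<^sup>2)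
    has_sum (b * infsum (fiber_energy a b c f) UNIV)) UNIV"
proof -
  define g where "g = (\<lambda>(m,n). (cmod (L2_inner f (gabor_atom (\<lambda>t. indicator {0..<c} t) a b m n)))\<^sup>2)"
  have row: "((\<lambda>n. g (m, n)) has_sum (b * fiber_energy a b c f m)) UNIV" for m
    using has_sum_gabor_coefficients[OF assms(2-4)] by (simp add: g_def)
  have tot: "((\<lambda>m. b * fiber_energy a b c f m) has_sum (b * infsum (fiber_energy a b c f) UNIV)) UNIV"
    by (intro has_sum_cmult_right has_sum_infsum summable_fiber_energy assms)
  \<comment> \<open>Nonnegative terms with summable row sums are jointly summable, so the double sum
    may be taken row by row.\<close>
  have "g summable_on (SIGMA m:UNIV. UNIV)"
    by (rule summable_on_SigmaI[OF row]) (use tot in \<open>auto simp: summable_on_def g_def\<close>)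
  from has_sum_SigmaI[OF row tot this] show ?thesis by (simp add: g_def)
qed

text \<open>The upper bound always holds by \<open>sum_fiber_energy_le\<close>, so the lower bound
  alone decides; the factor \<open>b\<close> from Parseval's identity is absorbed into the
  constant.\<close>

lemma gabor_frame_indicator_iff:
  assumes "a > 0" "b > 0" "c > 0"
  shows "gabor_frame (\<lambda>t. indicator {0..<c} t) a b \<longleftrightarrow>
    (\<exists>A>0. \<forall>f. L2 f \<longrightarrow> A * L2_normsq f \<le> infsum (fiber_energy a b c f) UNIV)"
proof
  assume "gabor_frame (\<lambda>t. indicator {0..<c} t) a b"
  then obtain A where A: "A > 0" "\<And>f. L2 f \<Longrightarrow> A * L2_normsq f \<le> (\<Sum>\<^sub>\<infinity>(m,n)\<in>UNIV. (cmod (L2_inner f (gabor_atom (\<lambda>t. indicator {0..<c} t) a b m n)))\<^sup>2)"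
    unfolding gabor_frame_def by blast
  have "A / b * L2_normsq f \<le> infsum (fiber_energy a b c f) UNIV" if "L2 f" for f
    using A(2)[OF that] infsumI[OF has_sum_gabor_frame_operator[OF assms that]] assms(2)
    by (simp add: field_simps)
  then show "\<exists>A>0. \<forall>f. L2 f \<longrightarrow> A * L2_normsq f \<le> infsum (fiber_energy a b c f) UNIV"
    using A(1) assms(2) by (intro exI[of _ "A / b"]) auto
next
  assume "\<exists>A>0. \<forall>f. L2 f \<longrightarrow> A * L2_normsq f \<le> infsum (fiber_energy a b c f) UNIV"
  then obtain A where A: "A > 0" "\<And>f. L2 f \<Longrightarrow> A * L2_normsq f \<le> infsum (fiber_energy a b c f) UNIV"
    by blast
  define B where "B = b * (of_int (\<lfloor>c / b\<rfloor> + 1) * (c / a + 1))"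
  show "gabor_frame (\<lambda>t. indicator {0..<c} t) a b"
    unfolding gabor_frame_def
  \<comment> \<open>The maximum secures the requirement that the lower constant not exceed the upper
    one.\<close>
  proof (rule exI[of _ "b * A"], rule exI[of _ "max B (b * A)"], intro conjI allI impI)
    fix f assume f: "L2 f"
    note hs = has_sum_gabor_frame_operator[OF assms f]
    have nn: "L2_normsq f \<ge> 0" by (simp add: L2_normsq_def)
    show "(\<lambda>(m,n). (cmod (L2_inner f (gabor_atom (\<lambda>t. indicator {0..<c} t) a b m n)))\<^sup>2) summable_on UNIV"
      using hs by (auto simp: summable_on_def)
    show "b * A * L2_normsq f \<le> (\<Sum>\<^sub>\<infinity>(m,n)\<in>UNIV. (cmod (L2_inner f (gabor_atom (\<lambda>t. indicator {0..<c} t) a b m n)))\<^sup>2)"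
      unfolding infsumI[OF hs] using A(2)[OF f] assms by (simp add: mult.assoc)
    have "infsum (fiber_energy a b c f) UNIV \<le> of_int (\<lfloor>c / b\<rfloor> + 1) * (c / a + 1) * L2_normsq f"
      by (intro infsum_le_finite_sums summable_fiber_energy sum_fiber_energy_le assms f) auto
    then have "b * infsum (fiber_energy a b c f) UNIV \<le> B * L2_normsq f"
      unfolding B_def using assms by (simp add: mult.assoc)
    also have "\<dots> \<le> max B (b * A) * L2_normsq f"
      using nn by (intro mult_right_mono) auto
    finally show "(\<Sum>\<^sub>\<infinity>(m,n)\<in>UNIV. (cmod (L2_inner f (gabor_atom (\<lambda>t. indicator {0..<c} t) a b m n)))\<^sup>2) \<le> max B (b * A) * L2_normsq f"
      unfolding infsumI[OF hs] .
  qed (use A(1) assms in auto)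
qed

section \<open>Lower frame bound from a pointwise estimate\<close>

lemma finite_shifts_near:
  fixes a t R :: real
  assumes a: "a > 0"
  shows "finite {m::int. \<bar>t - of_int m * a\<bar> \<le> R}"
proof -
  have "{m::int. \<bar>t - of_int m * a\<bar> \<le> R} \<subseteq> {\<lfloor>(t - R) / a\<rfloor>..\<lceil>(t + R) / a\<rceil>}"
  proof
    fix m :: int assume "m \<in> {m::int. \<bar>t - of_int m * a\<bar> \<le> R}"
    then have "(t - R) / a \<le> of_int m" "of_int m \<le> (t + R) / a" using a by (auto simp: field_simps abs_le_iff)
    then show "m \<in> {\<lfloor>(t - R) / a\<rfloor>..\<lceil>(t + R) / a\<rceil>}"
      by (auto simp: floor_le_iff le_ceiling_iff)
  qed
  then show ?thesis by (rule finite_subset) simp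
qed

text \<open>Seen from \<open>m a\<close>, the integrand is the \<open>b\<close>-periodic extension
  of the squared row, and \<open>[-Q b, Q b]\<close> is covered by \<open>2 * Q + 1\<close>
  periods.\<close>

lemma nn_integral_periodized_fiber_le:
  assumes b: "b > 0" and c: "c > 0" and f: "L2 f" and Q: "Q \<ge> 0"
  shows "(\<integral>\<^sup>+t. ennreal ((cmod (fiber a b c f m (t - of_int m * a - of_int \<lfloor>(t - of_int m * a) / b\<rfloor> * b)))\<^sup>2)
      * indicator {t. \<bar>t - of_int m * a\<bar> \<le> of_int Q * b} t \<partial>lborel)
    \<le> ennreal (of_int (2 * Q + 1)) * ennreal (fiber_energy a b c f m)"
proof -
  have [measurable]: "fiber a b c f m \<in> borel_measurable borel"
    using f by (intro fiber_measurable L2_measurable)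
  define P where "P = (\<lambda>u. ennreal ((cmod (fiber a b c f m (u - of_int \<lfloor>u / b\<rfloor> * b)))\<^sup>2))"
  have [measurable]: "P \<in> borel_measurable borel" unfolding P_def by measurable
  have "(\<integral>\<^sup>+t. P (t - of_int m * a) * indicator {t. \<bar>t - of_int m * a\<bar> \<le> of_int Q * b} t \<partial>lborel)
    = (\<integral>\<^sup>+u. P (of_int m * a + 1 * u - of_int m * a) * indicator {t. \<bar>t - of_int m * a\<bar> \<le> of_int Q * b} (of_int m * a + 1 * u) \<partial>lborel)"
    by (subst nn_integral_real_affine[where c = 1 and t = "of_int m * a"]) auto
  also have "\<dots> \<le> (\<integral>\<^sup>+u. P u * indicator {of_int (- Q) * b..<of_int (Q + 1) * b} u \<partial>lborel)"
    using b by (intro nn_integral_mono) (auto simp: abs_le_iff algebra_simps split: split_indicator)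
  also have "\<dots> = (\<integral>\<^sup>+s. (\<Sum>i\<in>{- Q..<Q + 1}. P (s + of_int i * b)) \<partial>period_measure b)"
    by (rule nn_integral_tiles[OF b, symmetric]) measurable
  also have "\<dots> = (\<integral>\<^sup>+s. ennreal (of_int (2 * Q + 1)) * ennreal ((cmod (fiber a b c f m s))\<^sup>2) \<partial>period_measure b)"
  proof (rule nn_integral_cong_AE, rule AE_period_measure, rule AE_I2, rule impI)
    fix s assume s: "s \<in> {0..<b}"
    have "P (s + of_int i * b) = ennreal ((cmod (fiber a b c f m s))\<^sup>2)" for i
    proof -
      have "s + of_int i * b \<in> {of_int i * b..<(of_int i + 1) * b}" using s by (auto simp: algebra_simps)
      then have "\<lfloor>(s + of_int i * b) / b\<rfloor> = i" using floor_divide_eq_iff_tile[OF b] by blast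
      then show ?thesis by (simp add: P_def)
    qed
    then show "(\<Sum>i\<in>{- Q..<Q + 1}. P (s + of_int i * b)) = ennreal (of_int (2 * Q + 1)) * ennreal ((cmod (fiber a b c f m s))\<^sup>2)"
      using Q by (simp add: ennreal_of_nat_eq_real_of_nat)
  qed
  also have "\<dots> = ennreal (of_int (2 * Q + 1)) * ennreal (fiber_energy a b c f m)"
    by (simp add: nn_integral_cmult ennreal_fiber_energy[OF b c f])
  finally show ?thesis by (simp add: P_def)
qed

text \<open>When \<open>f t\<close> is controlled by the rows with \<open>m a\<close> within
  \<open>Q b\<close> of \<open>t\<close>, integration yields a lower frame bound, because each row
  is charged at most \<open>2 * Q + 1\<close> times.\<close>

lemma gabor_frame_indicator_if_pointwise:
  assumes a: "a > 0" and b: "b > 0" and c: "c > 0" and C: "C > 0" and Q: "Q \<ge> 0"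
    and pw: "\<And>f t. (cmod (f t))\<^sup>2 \<le> C * (\<Sum>m | \<bar>t - of_int m * a\<bar> \<le> of_int Q * b.
       (cmod (fiber a b c f m (t - of_int m * a - of_int \<lfloor>(t - of_int m * a) / b\<rfloor> * b)))\<^sup>2)"
  shows "gabor_frame (\<lambda>t. indicator {0..<c} t) a b"
  unfolding gabor_frame_indicator_iff[OF a b c]
proof (intro exI[of _ "1 / (C * of_int (2 * Q + 1))"] conjI allI impI)
  show "0 < 1 / (C * of_int (2 * Q + 1))" using C Q by simp
  fix f assume f: "L2 f"
  have [measurable]: "f \<in> borel_measurable borel" using f by (rule L2_measurable)
  have [measurable]: "fiber a b c f m \<in> borel_measurable borel" for m
    using f by (intro fiber_measurable L2_measurable)
  define S where "S = infsum (fiber_energy a b c f) UNIV"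
  have S0: "S \<ge> 0" unfolding S_def by (rule infsum_nonneg) (simp add: fiber_energy_nonneg)
  define F where "F = (\<lambda>m t. (cmod (fiber a b c f m (t - of_int m * a - of_int \<lfloor>(t - of_int m * a) / b\<rfloor> * b)))\<^sup>2)"
  define D where "D = (\<lambda>m. {t. \<bar>t - of_int m * a\<bar> \<le> of_int Q * b})"
  have [measurable]: "F m \<in> borel_measurable borel" for m unfolding F_def by measurable
  have D[measurable]: "D m \<in> sets borel" for m unfolding D_def by measurable
  have loc: "(\<integral>\<^sup>+t. ennreal ((cmod (f t))\<^sup>2) * indicator {- real R..real R} t \<partial>lborel) \<le> ennreal (C * of_int (2 * Q + 1) * S)" for R
  proof -
    \<comment> \<open>All rows that can matter for some \<open>t\<close> in \<open>[-R, R]\<close>;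
      being finitely many, they allow the sum and the integral to be exchanged.\<close>
    define M where "M = {m. \<bar>0 - of_int m * a\<bar> \<le> real R + of_int Q * b}"
    have M: "finite M" unfolding M_def by (rule finite_shifts_near[OF a])
    have "(\<integral>\<^sup>+t. ennreal ((cmod (f t))\<^sup>2) * indicator {- real R..real R} t \<partial>lborel)
      \<le> (\<integral>\<^sup>+t. ennreal C * (\<Sum>m\<in>M. ennreal (F m t) * indicator (D m) t) \<partial>lborel)"
    proof (rule nn_integral_mono)
      fix t
      show "ennreal ((cmod (f t))\<^sup>2) * indicator {- real R..real R} t \<le> ennreal C * (\<Sum>m\<in>M. ennreal (F m t) * indicator (D m) t)"
      proof (cases "t \<in> {- real R..real R}")
        case True
        have "(cmod (f t))\<^sup>2 \<le> C * (\<Sum>m | \<bar>t - of_int m * a\<bar> \<le> of_int Q * b. F m t)"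
          using pw[of f t] by (simp add: F_def)
        also have "(\<Sum>m | \<bar>t - of_int m * a\<bar> \<le> of_int Q * b. F m t) = (\<Sum>m\<in>M. F m t * indicator (D m) t)"
          using True M
          by (intro sum.mono_neutral_cong_left) (auto simp: M_def D_def)
        finally have "ennreal ((cmod (f t))\<^sup>2) \<le> ennreal (C * (\<Sum>m\<in>M. F m t * indicator (D m) t))"
          by (rule ennreal_leI)
        also have "\<dots> = ennreal C * (\<Sum>m\<in>M. ennreal (F m t * indicator (D m) t))"
          using C by (subst ennreal_mult) (auto intro!: sum_nonneg simp: F_def sum_ennreal)
        also have "\<dots> = ennreal C * (\<Sum>m\<in>M. ennreal (F m t) * indicator (D m) t)"
          by (intro arg_cong2[where f = "(*)"] sum.cong refl) (auto split: split_indicator)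
        finally show ?thesis using True by simp
      qed simp
    qed
    also have "\<dots> = ennreal C * (\<Sum>m\<in>M. \<integral>\<^sup>+t. ennreal (F m t) * indicator (D m) t \<partial>lborel)"
      by (subst nn_integral_cmult) (auto simp: nn_integral_sum)
    also have "\<dots> \<le> ennreal C * (\<Sum>m\<in>M. ennreal (of_int (2 * Q + 1)) * ennreal (fiber_energy a b c f m))"
      unfolding F_def D_def by (intro mult_left_mono sum_mono nn_integral_periodized_fiber_le b c f Q) simp
    also have "\<dots> = ennreal (C * of_int (2 * Q + 1) * (\<Sum>m\<in>M. fiber_energy a b c f m))"
    proof -
      have "(\<Sum>m\<in>M. ennreal (of_int (2 * Q + 1)) * ennreal (fiber_energy a b c f m))
        = ennreal (of_int (2 * Q + 1)) * ennreal (\<Sum>m\<in>M. fiber_energy a b c f m)"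
        unfolding sum_distrib_left[symmetric] by (simp add: sum_ennreal fiber_energy_nonneg)
      then show ?thesis
        using C Q by (simp only: mult.assoc) (simp add: ennreal_mult[symmetric] sum_nonneg fiber_energy_nonneg del: ennreal_plus of_int_add)
    qed
    also have "\<dots> \<le> ennreal (C * of_int (2 * Q + 1) * S)"
      unfolding S_def using C Q M
      by (intro ennreal_leI mult_left_mono finite_sum_le_infsum summable_fiber_energy a b c f)
        (auto simp: fiber_energy_nonneg)
    finally show ?thesis .
  qed
  \<comment> \<open>Monotone convergence removes the cutoff to \<open>[-R, R]\<close>, since the
    local bound does not depend on \<open>R\<close>.\<close>
  have "ennreal (L2_normsq f) = (\<integral>\<^sup>+t. (SUP R. ennreal ((cmod (f t))\<^sup>2) * indicator {- real R..real R} t) \<partial>lborel)"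
    unfolding L2_normsq_eq_nn_integral[OF f]
  proof (rule nn_integral_cong)
    fix t
    obtain R where R: "\<bar>t\<bar> \<le> real R" using real_arch_simple by blast
    show "ennreal ((cmod (f t))\<^sup>2) = (SUP R. ennreal ((cmod (f t))\<^sup>2) * indicator {- real R..real R} t)"
    proof (rule antisym)
      show "ennreal ((cmod (f t))\<^sup>2) \<le> (SUP R. ennreal ((cmod (f t))\<^sup>2) * indicator {- real R..real R} t)"
        by (rule SUP_upper2[of R]) (use R in \<open>auto simp: indicator_def abs_le_iff\<close>)
    qed (auto intro!: SUP_least split: split_indicator)
  qed
  also have "\<dots> = (SUP R. \<integral>\<^sup>+t. ennreal ((cmod (f t))\<^sup>2) * indicator {- real R..real R} t \<partial>lborel)"
    by (rule nn_integral_monotone_convergence_SUP)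
      (auto simp: incseq_def le_fun_def split: split_indicator)
  also have "\<dots> \<le> ennreal (C * of_int (2 * Q + 1) * S)"
    by (rule SUP_least) (rule loc)
  finally have "L2_normsq f \<le> C * of_int (2 * Q + 1) * S"
    using C Q S0 by (subst (asm) ennreal_le_iff) auto
  then show "1 / (C * of_int (2 * Q + 1)) * L2_normsq f \<le> infsum (fiber_energy a b c f) UNIV"
    using mult_pos_pos[of C "of_int (2 * Q + 1)"] C Q unfolding S_def[symmetric]
    by (simp add: pos_divide_le_eq mult_ac)
qed

subsection \<open>Arcs, residue classes and windows\<close>

text \<open>Coprimality gives \<open>gcd (N * q) p = gcd N p\<close>, so Bezout's identity yields a
  solution. Reducing \<open>l\<close> modulo \<open>p\<close> is compensated in \<open>m\<close> and
  bounds the waiting time by \<open>p\<close>.\<close>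

lemma linear_congruence_solvable:
  fixes N p q z :: int
  assumes p: "p > 0" and pq: "coprime p q" and z: "gcd N p dvd z"
  obtains l m where "0 \<le> l" "l < p" "l * N * q - m * p = z"
proof -
  have "gcd (N * q) p = gcd N p"
    using pq by (metis gcd.commute gcd_mult_right_right_cancel)
  then obtain u v where uv: "u * (N * q) + v * p = gcd N p"
    using bezout_int[of "N * q" p] by auto
  obtain w where w: "z = gcd N p * w" using z by (elim dvdE)
  define l0 where "l0 = w * u"
  define l where "l = l0 mod p"
  define m where "m = w * v + (l0 div p) * N * q"
  have l0: "l0 = l0 div p * p + l" unfolding l_def by simp
  have "l0 * N * q + w * v * p = z" unfolding l0_def w uv[symmetric] by (simp add: algebra_simps)
  then have "(l0 div p * p + l) * N * q + w * v * p = z" using l0 by metis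
  then have "l * N * q - (- m) * p = z" unfolding m_def by (simp add: algebra_simps)
  moreover have "0 \<le> l" "l < p" using p by (auto simp: l_def)
  ultimately show ?thesis using that by blast
qed

text \<open>For \<open>a / b = p / q\<close> in lowest terms, the points of one class modulo
  \<open>N\<close> occupy modulo \<open>a\<close> a translate of the multiples of
  \<open>gcd N p * b / q\<close>. An arc shorter than this spacing can be missed. If
  \<open>gcd N p < N\<close>, different classes share a translate and miss the arc together; if
  \<open>gcd N p = N\<close>, the translates are distinct and differ by multiples of
  \<open>b / q\<close>, so missing two classes takes a further \<open>b / q\<close> of room.\<close>

definition bad_ratio :: "real \<Rightarrow> real \<Rightarrow> int \<Rightarrow> real \<Rightarrow> bool" where
  "bad_ratio a b N L \<longleftrightarrow> (\<exists>p q :: int. 0 < p \<and> 0 < q \<and> coprime p q \<and> a / b = of_int p / of_int q \<and>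
     ((L < of_int (gcd N p) * b / of_int q \<and> gcd N p \<noteq> N) \<or>
      (L < of_int (gcd N p) * b / of_int q - b / of_int q \<and> gcd N p = N)))"

text \<open>Dirichlet's theorem supplies a multiple of \<theta> that moves points modulo
  \<open>a\<close> by some \<open>d\<close> with \<open>\<bar>d\<bar> < L\<close>, and irrationality
  gives \<open>d \<noteq> 0\<close>. Walking in such short steps cannot jump over the arc, and the
  number of steps is bounded uniformly in \<open>x\<close>.\<close>

lemma irrational_orbit_hits_arc:
  fixes a \<theta> L :: real
  assumes a: "a > 0" and L: "L > 0" and irr: "\<theta> / a \<notin> \<rat>"
  obtains K :: int where "\<And>x. \<exists>l\<in>{0..K}. \<exists>m::int. 0 \<le> x + of_int l * \<theta> - of_int m * a \<and> x + of_int l * \<theta> - of_int m * a < L"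
proof -
  obtain n :: nat where n: "a / L < real n" using reals_Archimedean2 by blast
  have "0 < a / L" using a L by simp
  then have n0: "n > 0" using n by (cases n) auto
  obtain l1 h where lh: "0 < l1" "\<bar>of_int l1 * (\<theta> / a) - of_int h\<bar> < 1 / real n"
    using Dirichlet_approx[OF n0, of "\<theta> / a"] by metis
  define d where "d = of_int l1 * \<theta> - of_int h * a"
  have da: "d = a * (of_int l1 * (\<theta> / a) - of_int h)" using a by (simp add: d_def algebra_simps)
  have "\<bar>d\<bar> < a * (1 / real n)"
    unfolding da abs_mult abs_of_pos[OF a] by (rule mult_strict_left_mono[OF lh(2) a])
  also have "\<dots> < L" using n a L n0 by (simp add: field_simps)
  finally have dL: "\<bar>d\<bar> < L" .
  have d0: "d \<noteq> 0"
  proof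
    assume "d = 0"
    then have "\<theta> / a = of_int h / of_int l1" using a lh(1) by (simp add: d_def field_simps)
    then show False using irr by (metis Rats_divide Rats_of_int)
  qed
  \<comment> \<open>The walk takes at most \<open>\<lceil>a / \<bar>d\<bar>\<rceil> + 1\<close>
    steps, each consisting of \<open>l1\<close> rotations by \<theta>.\<close>
  define K where "K = l1 * (\<lceil>a / \<bar>d\<bar>\<rceil> + 1)"
  have "\<exists>l\<in>{0..K}. \<exists>m::int. 0 \<le> x + of_int l * \<theta> - of_int m * a \<and> x + of_int l * \<theta> - of_int m * a < L" for x
  proof -
    define y where "y = x - of_int \<lfloor>x / a\<rfloor> * a"
    have y: "0 \<le> y" "y < a"
      using floor_divide_lower[OF a, of x] floor_divide_upper[OF a, of x] by (auto simp: y_def algebra_simps)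
    have "\<exists>i m'::int. 0 \<le> i \<and> i \<le> \<lceil>a / \<bar>d\<bar>\<rceil> + 1 \<and> 0 \<le> y - of_int m' * a + of_int i * d \<and> y - of_int m' * a + of_int i * d < L"
    proof (cases "d > 0")
      case True
      \<comment> \<open>Moving right from \<open>y\<close>: the first step that reaches
        \<open>a\<close>, which is \<open>0\<close> modulo \<open>a\<close>, overshoots it by less
        than \<open>d < L\<close>.\<close>
      define i where "i = \<lceil>(a - y) / d\<rceil>"
      have i: "(a - y) / d \<le> of_int i" "of_int i < (a - y) / d + 1"
        unfolding i_def using ceiling_correct[of "(a - y) / d"] by linarith+
      have "0 \<le> (a - y) / d" using y True by simp
      then have "0 \<le> i" using i(1) by linarith
      moreover have "i \<le> \<lceil>a / \<bar>d\<bar>\<rceil> + 1"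
      proof -
        have "(a - y) / d \<le> a / \<bar>d\<bar>" using True y by (simp add: divide_right_mono)
        then have "i \<le> \<lceil>a / \<bar>d\<bar>\<rceil>" unfolding i_def by (rule ceiling_mono)
        then show ?thesis by simp
      qed
      moreover have "0 \<le> y - of_int 1 * a + of_int i * d" using i(1) True by (simp add: field_simps)
      moreover have "y - of_int 1 * a + of_int i * d < L"
      proof -
        have "of_int i * d < (a - y) + d" using i(2) True by (simp add: field_simps)
        then show ?thesis using dL True by simp
      qed
      ultimately show ?thesis by blast
    next
      case False
      then have dn: "d < 0" using d0 by simp
      \<comment> \<open>Moving left from \<open>y\<close>: the last step that stays nonnegative
        leaves a remainder below \<open>\<bar>d\<bar> < L\<close>.\<close>
      define i where "i = \<lfloor>y / \<bar>d\<bar>\<rfloor>"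
      have i: "of_int i \<le> y / \<bar>d\<bar>" "y / \<bar>d\<bar> < of_int i + 1"
        unfolding i_def by linarith+
      have "0 \<le> i" unfolding i_def using y by simp
      moreover have "i \<le> \<lceil>a / \<bar>d\<bar>\<rceil> + 1"
      proof -
        have "y / \<bar>d\<bar> \<le> a / \<bar>d\<bar>" using y by (simp add: divide_right_mono)
        then show ?thesis unfolding i_def by linarith
      qed
      moreover have "0 \<le> y - of_int 0 * a + of_int i * d" using i(1) dn by (simp add: field_simps)
      moreover have "y - of_int 0 * a + of_int i * d < L"
      proof -
        have "y < (of_int i + 1) * \<bar>d\<bar>" using i(2) dn by (simp add: field_simps)
        then show ?thesis using dL dn by (simp add: algebra_simps)
      qed
      ultimately show ?thesis by blast
    qed
    then obtain i m' :: int where i: "0 \<le> i" "i \<le> \<lceil>a / \<bar>d\<bar>\<rceil> + 1"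
      and hit: "0 \<le> y - of_int m' * a + of_int i * d" "y - of_int m' * a + of_int i * d < L" by blast
    have "y - of_int m' * a + of_int i * d
      = x + of_int (i * l1) * \<theta> - of_int (\<lfloor>x / a\<rfloor> + m' + i * h) * a"
      by (simp add: y_def d_def algebra_simps)
    moreover have "i * l1 \<in> {0..K}"
      using i lh(1) by (auto simp: K_def mult.commute intro: mult_left_mono)
    ultimately show ?thesis using hit by metis
  qed
  then show ?thesis using that by blast
qed

text \<open>The classes modulo \<open>N\<close> play the role of unknowns: every class hit by the arc forces a zero,
  and a single class missed is still determined by the vanishing sum over a period.\<close>

lemma all_but_one_class_hit:
  fixes a b L :: real and N :: int
  assumes a: "a > 0" and b: "b > 0" and L: "L > 0" and N: "N \<ge> 1" and good: "\<not> bad_ratio a b N L"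
  obtains K :: int where "K \<ge> 0"
    "\<And>t. \<exists>r0. \<forall>r\<in>{0..<N}. r \<noteq> r0 \<longrightarrow>
      (\<exists>l\<in>{0..K}. \<exists>m::int. 0 \<le> of_int (r + N * l) * b + t - of_int m * a \<and> of_int (r + N * l) * b + t - of_int m * a < L)"
proof (cases "a / b \<in> \<rat>")
  case False
  \<comment> \<open>Successive points of one class are \<open>N * b\<close> apart, so this is the
    rotation number of a single class modulo \<open>a\<close>.\<close>
  have "of_int N * b / a \<notin> \<rat>"
  proof
    assume "of_int N * b / a \<in> \<rat>"
    then have "of_int N / (of_int N * b / a) \<in> \<rat>" by (rule Rats_divide[OF Rats_of_int])
    moreover have "of_int N / (of_int N * b / a) = a / b" using N a b by simp
    ultimately show False using False by simp
  qed
  from irrational_orbit_hits_arc[OF a L this]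
  obtain K :: int where K: "\<And>x. \<exists>l\<in>{0..K}. \<exists>m::int. 0 \<le> x + of_int l * (of_int N * b) - of_int m * a \<and> x + of_int l * (of_int N * b) - of_int m * a < L"
    by blast
  show ?thesis
  proof (rule that)
    show "K \<ge> 0" using K[of 0] by auto
    fix t
    have "\<exists>l\<in>{0..K}. \<exists>m::int. 0 \<le> of_int (r + N * l) * b + t - of_int m * a \<and> of_int (r + N * l) * b + t - of_int m * a < L" for r
      using K[of "of_int r * b + t"] by (simp add: algebra_simps)
    then show "\<exists>r0. \<forall>r\<in>{0..<N}. r \<noteq> r0 \<longrightarrow>
      (\<exists>l\<in>{0..K}. \<exists>m::int. 0 \<le> of_int (r + N * l) * b + t - of_int m * a \<and> of_int (r + N * l) * b + t - of_int m * a < L)"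
      by blast
  qed
next
  case True
  then obtain p q where q: "q > 0" and pq: "coprime p q" and ab: "a / b = of_int p / of_int q"
    by (rule Rats_cases')
  have "0 < a / b" using a b by simp
  then have p: "p > 0" using q unfolding ab by (simp add: zero_less_divide_iff)
  define h where "h = b / of_int q"
  have h: "h > 0" "b = of_int q * h" using b q by (auto simp: h_def)
  have ah: "a = of_int p * h" using ab b q by (simp add: h_def field_simps)
  define d where "d = gcd N p"
  have d: "d > 0" using p by (simp add: d_def)
  have nb: "d \<noteq> N \<Longrightarrow> L \<ge> of_int d * h" "d = N \<Longrightarrow> L \<ge> of_int d * h - h"
  proof -
    have "\<not> ((L < of_int (gcd N p) * b / of_int q \<and> gcd N p \<noteq> N) \<or>
      (L < of_int (gcd N p) * b / of_int q - b / of_int q \<and> gcd N p = N))"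
      using good p q pq ab unfolding bad_ratio_def by blast
    then show "d \<noteq> N \<Longrightarrow> L \<ge> of_int d * h" "d = N \<Longrightarrow> L \<ge> of_int d * h - h"
      by (auto simp: d_def h_def)
  qed
  \<comment> \<open>In units of \<open>h = b / q\<close>, a class can be moved modulo
    \<open>a\<close> by any multiple \<open>z\<close> of \<open>d\<close> within \<open>p\<close>
    rounds.\<close>
  have solve: "\<exists>l\<in>{0..p}. \<exists>m::int. of_int (r + N * l) * b + t - of_int m * a = t + of_int (r * q + z) * h"
    if "d dvd z" for r z t
  proof -
    obtain l m where lm: "0 \<le> l" "l < p" "l * N * q - m * p = z"
      using linear_congruence_solvable[OF p pq, of N z] \<open>d dvd z\<close> unfolding d_def by blast
    have "of_int (r + N * l) * b + t - of_int m * a = t + of_int (r * q + (l * N * q - m * p)) * h"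
      unfolding h(2) ah by (simp add: algebra_simps)
    then show ?thesis using lm by (intro bexI[of _ l] exI[of _ m]) auto
  qed
  show ?thesis
  proof (rule that[of p])
    show "0 \<le> p" using p by simp
    fix t
    show "\<exists>r0. \<forall>r\<in>{0..<N}. r \<noteq> r0 \<longrightarrow>
      (\<exists>l\<in>{0..p}. \<exists>m::int. 0 \<le> of_int (r + N * l) * b + t - of_int m * a \<and> of_int (r + N * l) * b + t - of_int m * a < L)"
    proof (cases "d = N")
      case False
      \<comment> \<open>The spacing \<open>d * h\<close> is at most \<open>L\<close>, so every class
        meets the arc and no exceptional class occurs.\<close>
      have "\<exists>l\<in>{0..p}. \<exists>m::int. 0 \<le> of_int (r + N * l) * b + t - of_int m * a \<and> of_int (r + N * l) * b + t - of_int m * a < L" for r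
      proof -
        define x where "x = t + of_int (r * q) * h"
        define e where "e = \<lfloor>x / (of_int d * h)\<rfloor>"
        have dh: "of_int d * h > 0" using d h by simp
        have xe: "0 \<le> x - of_int e * (of_int d * h)" "x - of_int e * (of_int d * h) < of_int d * h"
          using floor_divide_lower[OF dh, of x] floor_divide_upper[OF dh, of x] by (auto simp: e_def algebra_simps)
        obtain l m where l: "l \<in> {0..p}"
          and "of_int (r + N * l) * b + t - of_int m * a = t + of_int (r * q + d * (- e)) * h"
          using solve[of "d * (- e)" r t] by auto
        then have "of_int (r + N * l) * b + t - of_int m * a = x - of_int e * (of_int d * h)"
          by (simp add: x_def algebra_simps)
        then show ?thesis using xe nb(1)[OF False] l by (intro bexI[of _ l] exI[of _ m]) auto
      qed
      then show ?thesis by blast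
    next
      case True
      \<comment> \<open>Now the spacing is \<open>N * h\<close>, and class \<open>r\<close> has a
        point at \<open>y + j * h\<close> with \<open>j = (r * q + e) mod N\<close>. The arc has
        length at least \<open>(N - 1) * h\<close>, so only \<open>j = N - 1\<close> can be missed;
        as \<open>q\<close> is invertible modulo \<open>N\<close>, this concerns at most one
        class.\<close>
      define e where "e = \<lfloor>t / h\<rfloor>"
      define y where "y = t - of_int e * h"
      have y: "0 \<le> y" "y < h"
        using floor_divide_lower[OF h(1), of t] floor_divide_upper[OF h(1), of t] by (auto simp: y_def e_def algebra_simps)
      have cq: "coprime q N"
        using pq True unfolding d_def by (metis coprime_commute coprime_divisors dvd_refl gcd_dvd2)
      have hit: "\<exists>l\<in>{0..p}. \<exists>m::int. 0 \<le> of_int (r + N * l) * b + t - of_int m * a \<and> of_int (r + N * l) * b + t - of_int m * a < L"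
        if r: "(r * q + e) mod N \<noteq> N - 1" for r
      proof -
        define j where "j = (r * q + e) mod N"
        have "0 \<le> j" "j < N" "j \<noteq> N - 1"
          using r N pos_mod_sign[of N "r * q + e"] pos_mod_bound[of N "r * q + e"] by (simp_all add: j_def)
        then have j: "0 \<le> j" "j \<le> N - 2" by auto
        have "d dvd j - (r * q + e)" unfolding True j_def
          by (metis dvd_minus_mod dvd_diff_commute)
        then obtain l m where l: "l \<in> {0..p}"
          and "of_int (r + N * l) * b + t - of_int m * a = t + of_int (r * q + (j - (r * q + e))) * h"
          using solve[of "j - (r * q + e)" r t] by auto
        then have eq: "of_int (r + N * l) * b + t - of_int m * a = y + of_int j * h"
          by (simp add: y_def algebra_simps)
        have "of_int j * h \<le> of_int (N - 2) * h" using j h(1) by (intro mult_right_mono) auto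
        then have "y + of_int j * h < of_int N * h - h" using y by (simp add: algebra_simps)
        moreover have "0 \<le> of_int j * h" using j h(1) by simp
        ultimately show ?thesis
          using y nb(2)[OF True] l eq True by (intro bexI[of _ l] exI[of _ m]) auto
      qed
      have uniq: "r = r'" if "r \<in> {0..<N}" "r' \<in> {0..<N}" "(r * q + e) mod N = (r' * q + e) mod N" for r r'
      proof -
        have "N dvd (r * q + e) - (r' * q + e)" using that(3) by (simp add: mod_eq_dvd_iff)
        then have "N dvd (r - r') * q" by (simp add: algebra_simps)
        then have "N dvd r - r'" using cq by (simp add: coprime_dvd_mult_left_iff coprime_commute)
        then have "r mod N = r' mod N" by (simp add: mod_eq_dvd_iff)
        then show ?thesis using that(1,2) by simp
      qed
      show ?thesis
      proof (cases "\<exists>r\<in>{0..<N}. (r * q + e) mod N = N - 1")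
        case True
        then obtain r0 where "r0 \<in> {0..<N}" "(r0 * q + e) mod N = N - 1" by blast
        then show ?thesis using hit uniq by metis
      next
        case False
        then show ?thesis using hit by blast
      qed
    qed
  qed
qed

text \<open>The counting in the other direction: the classes of \<open>0\<close> and
  \<open>r\<close> avoid the arc for a whole interval of offsets \<open>t\<close>. The positive
  length of the interval later gives test functions of positive norm.\<close>

lemma two_classes_missed:
  fixes a b L :: real and N :: int
  assumes a: "a > 0" and b: "b > 0" and L: "L \<ge> 0" and N: "N \<ge> 1" and bad: "bad_ratio a b N L"
  obtains \<tau> \<epsilon> :: real and r :: int where "\<epsilon> > 0" "\<not> N dvd r"
    "\<And>t j m. \<tau> \<le> t \<Longrightarrow> t < \<tau> + \<epsilon> \<Longrightarrow> N dvd j \<or> N dvd j - r \<Longrightarrow>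
       \<not> (0 \<le> of_int j * b + t - of_int m * a \<and> of_int j * b + t - of_int m * a < L)"
proof -
  from bad obtain p q where p: "p > 0" and q: "q > 0" and pq: "coprime p q" and ab: "a / b = of_int p / of_int q"
    and cond: "(L < of_int (gcd N p) * b / of_int q \<and> gcd N p \<noteq> N) \<or>
      (L < of_int (gcd N p) * b / of_int q - b / of_int q \<and> gcd N p = N)"
    unfolding bad_ratio_def by blast
  define h where "h = b / of_int q"
  have h: "h > 0" "b = of_int q * h" using b q by (auto simp: h_def)
  have ah: "a = of_int p * h" using ab b q by (simp add: h_def field_simps)
  define d where "d = gcd N p"
  have d: "d > 0" "d dvd N" "d dvd p" using p by (auto simp: d_def)
  \<comment> \<open>If \<open>j * q\<close> is congruent to \<open>x\<close> modulo \<open>d\<close>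
    and \<open>t + x * h\<close> lies in \<open>[L, d * h)\<close>, the orbit, spaced by
    \<open>d * h\<close>, passes from below \<open>0\<close> directly to \<open>L\<close> or
    beyond.\<close>
  have miss: "\<not> (0 \<le> of_int j * b + t - of_int m * a \<and> of_int j * b + t - of_int m * a < L)"
    if x: "L \<le> t + of_int x * h" "t + of_int x * h < of_int d * h" "d dvd j * q - x" for t j m x
  proof
    assume hit: "0 \<le> of_int j * b + t - of_int m * a \<and> of_int j * b + t - of_int m * a < L"
    have "d dvd (j * q - x) - m * p" using d(3) by (intro dvd_diff[OF x(3)] dvd_mult)
    then obtain e where e: "j * q - m * p = x + d * e" by (elim dvdE) (auto simp: algebra_simps)
    have "of_int j * b + t - of_int m * a = t + of_int (j * q - m * p) * h"
      unfolding h(2) ah by (simp add: algebra_simps)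
    also have "\<dots> = (t + of_int x * h) + of_int e * (of_int d * h)" unfolding e by (simp add: algebra_simps)
    finally have eq: "of_int j * b + t - of_int m * a = (t + of_int x * h) + of_int e * (of_int d * h)" .
    have dh: "of_int d * h > 0" using d h by simp
    consider "e \<ge> 0" | "e \<le> - 1" by linarith
    then show False
    proof cases
      case 1
      then have "0 \<le> of_int e * (of_int d * h)" using dh by simp
      then show False using hit eq x(1) by linarith
    next
      case 2
      then have "of_int e * (of_int d * h) \<le> (- 1) * (of_int d * h)" using dh by (intro mult_right_mono) auto
      then show False using hit eq x(2) by linarith
    qed
  qed
  show ?thesis
  proof (cases "d = N")
    case False
    then have Ld: "L < of_int d * h" using cond by (auto simp: d_def h_def)
    have "d < N" using d(1,2) False N zdvd_imp_le[of d N] by simp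
    \<comment> \<open>The classes of \<open>0\<close> and \<open>d\<close> differ modulo
      \<open>N\<close>, but both have residue \<open>0\<close> modulo \<open>d\<close>, so they miss
      the arc together.\<close>
    show ?thesis
    proof (rule that[of "of_int d * h - L" d L])
      show "0 < of_int d * h - L" using Ld by simp
      show "\<not> N dvd d" using \<open>d < N\<close> d(1) zdvd_imp_le[of N d] by auto
      fix t j m assume t: "L \<le> t" "t < L + (of_int d * h - L)" and j: "N dvd j \<or> N dvd j - d"
      have "d dvd j" using j d(2) by (metis dvd_trans dvd_diffD dvd_refl zdvd_zdiffD)
      then show "\<not> (0 \<le> of_int j * b + t - of_int m * a \<and> of_int j * b + t - of_int m * a < L)"
        using t by (intro miss[of t 0]) auto
    qed
  next
    case True
    then have Ld: "L < of_int N * h - h" using cond by (auto simp: d_def h_def)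
    have cq: "coprime q N"
      using pq True unfolding d_def by (metis coprime_commute coprime_divisors dvd_refl gcd_dvd2)
    \<comment> \<open>With \<open>r\<close> an inverse of \<open>q\<close> modulo \<open>N\<close>,
      class \<open>r\<close> sits one step \<open>h\<close> beyond class \<open>0\<close>; both fit
      into the gap because \<open>L < (N - 1) * h\<close>.\<close>
    obtain r v where "r * q + v * N = 1" using bezout_int[of q N] cq by (auto simp: coprime_iff_gcd_eq_1)
    then have "r * q - 1 = N * (- v)" by (simp add: algebra_simps)
    then have r: "N dvd r * q - 1" by (rule dvdI)
    have N2: "N \<ge> 2"
    proof (rule ccontr)
      assume "\<not> N \<ge> 2"
      then have "N = 1" using N by simp
      then show False using Ld L by simp
    qed
    show ?thesis
    proof (rule that[of "of_int N * h - h - L" r L])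
      show "0 < of_int N * h - h - L" using Ld by simp
      show "\<not> N dvd r"
      proof
        assume "N dvd r"
        then have "N dvd r * q - (r * q - 1)" by (intro dvd_diff dvd_mult2 r)
        then show False using N2 by simp
      qed
      fix t j m assume t: "L \<le> t" "t < L + (of_int N * h - h - L)" and j: "N dvd j \<or> N dvd j - r"
      from j show "\<not> (0 \<le> of_int j * b + t - of_int m * a \<and> of_int j * b + t - of_int m * a < L)"
      proof
        assume "N dvd j"
        then show ?thesis using t h(1) True by (intro miss[of t 0]) auto
      next
        assume "N dvd j - r"
        then have "N dvd (j - r) * q + (r * q - 1)" by (intro dvd_add dvd_mult2 r)
        then have "N dvd j * q - 1" by (simp add: algebra_simps)
        then show ?thesis using t h(1) True by (intro miss[of t 1]) auto
      qed
    qed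
  qed
qed

text \<open>Quantitative form of uniqueness. Adjacent windows differ by
  \<open>v (i + N) - v i\<close>, so small windows make \<open>v\<close> nearly
  \<open>N\<close>-periodic. Samples known to be small are carried back to the first period, and the
  exceptional class is recovered from the window starting at \<open>0\<close>.\<close>

lemma window_system_bound:
  fixes v :: "int \<Rightarrow> complex" and N K r0 :: int
  assumes N: "N \<ge> 1" and K: "K \<ge> 0" and \<rho>: "\<rho> \<ge> 0"
    and win: "\<And>i. 0 \<le> i \<Longrightarrow> i \<le> N * (K + 1) \<Longrightarrow> cmod (\<Sum>j\<in>{0..<N}. v (i + j)) \<le> \<rho>"
    and zero: "\<And>r. r \<in> {0..<N} \<Longrightarrow> r \<noteq> r0 \<Longrightarrow> \<exists>l\<in>{0..K}. cmod (v (r + N * l)) \<le> 2 * \<rho>"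
  shows "cmod (v 0) \<le> (1 + 2 * of_int (N * (K + 1))) * \<rho>"
proof -
  have step: "cmod (v i) \<le> cmod (v (i + N)) + 2 * \<rho>" if "0 \<le> i" "i + 1 \<le> N * (K + 1)" for i
  proof -
    have "(\<Sum>j\<in>{0..<N}. v (i + 1 + j)) = (\<Sum>j\<in>{1..<N + 1}. v (i + j))"
      by (rule sum.reindex_bij_witness[of _ "\<lambda>j. j - 1" "\<lambda>j. j + 1"]) (auto simp: algebra_simps)
    moreover have "(\<Sum>j\<in>{1..<N + 1}. v (i + j)) + v i = (\<Sum>j\<in>{0..<N + 1}. v (i + j))"
    proof -
      have "{0..<N + 1} = insert 0 {1..<N + 1}" using N by auto
      then show ?thesis by simp
    qed
    moreover have "(\<Sum>j\<in>{0..<N + 1}. v (i + j)) = (\<Sum>j\<in>{0..<N}. v (i + j)) + v (i + N)"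
    proof -
      have "{0..<N + 1} = insert N {0..<N}" using N by auto
      then show ?thesis by simp
    qed
    ultimately have "v i = v (i + N) + (\<Sum>j\<in>{0..<N}. v (i + j)) - (\<Sum>j\<in>{0..<N}. v (i + 1 + j))"
      by (simp add: algebra_simps)
    then have "cmod (v i) \<le> cmod (v (i + N)) + cmod (\<Sum>j\<in>{0..<N}. v (i + j)) + cmod (\<Sum>j\<in>{0..<N}. v (i + 1 + j))"
      by (metis norm_triangle_ineq4 norm_triangle_ineq add_right_mono order_trans)
    then show ?thesis using win[of i] win[of "i + 1"] that by simp
  qed
  have steps: "cmod (v r) \<le> cmod (v (r + N * int l)) + 2 * \<rho> * real l"
    if "0 \<le> r" "r < N" "int l \<le> K" for r and l :: nat
    using that(3)
  proof (induction l)
    case 0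
    then show ?case by simp
  next
    case (Suc l)
    have "N * int (Suc l) \<le> N * K" using Suc.prems N by (intro mult_left_mono) auto
    moreover have "0 \<le> N * int l" using N by simp
    ultimately have "cmod (v (r + N * int l)) \<le> cmod (v (r + N * int l + N)) + 2 * \<rho>"
      using that N by (intro step) (auto simp: algebra_simps)
    moreover have "r + N * int l + N = r + N * int (Suc l)" by (simp add: algebra_simps)
    ultimately show ?case using Suc by (simp add: algebra_simps)
  qed
  have others: "cmod (v r) \<le> 2 * of_int (K + 1) * \<rho>" if "r \<in> {0..<N}" "r \<noteq> r0" for r
  proof -
    from zero[OF that] obtain l where l: "l \<in> {0..K}" "cmod (v (r + N * l)) \<le> 2 * \<rho>" by blast
    have "cmod (v r) \<le> cmod (v (r + N * l)) + 2 * \<rho> * of_int l"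
      using steps[of r "nat l"] that l by simp
    also have "\<dots> \<le> 2 * \<rho> + 2 * \<rho> * of_int K"
      using l \<rho> by (intro add_mono mult_left_mono) auto
    finally show ?thesis by (simp add: algebra_simps)
  qed
  show ?thesis
  proof (cases "r0 = 0")
    case False
    then have "cmod (v 0) \<le> 2 * of_int (K + 1) * \<rho>" using others[of 0] N by simp
    also have "\<dots> \<le> (1 + 2 * of_int (N * (K + 1))) * \<rho>"
    proof (intro mult_right_mono \<rho>)
      have "1 * (K + 1) \<le> N * (K + 1)" using N K by (intro mult_right_mono) auto
      then have "real_of_int (1 * (K + 1)) \<le> of_int (N * (K + 1))" by (simp only: of_int_le_iff)
      then show "2 * real_of_int (K + 1) \<le> 1 + 2 * of_int (N * (K + 1))" by simp
    qed
    finally show ?thesis .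
  next
    case True
    \<comment> \<open>The exceptional class is that of \<open>0\<close> itself, so
      \<open>v 0\<close> is the first window minus the other \<open>N - 1\<close> samples, all of
      them already bounded.\<close>
    have "{0..<N} = insert 0 {1..<N}" using N by auto
    then have "v 0 = (\<Sum>j\<in>{0..<N}. v (0 + j)) - (\<Sum>j\<in>{1..<N}. v j)" by simp
    then have "cmod (v 0) \<le> cmod (\<Sum>j\<in>{0..<N}. v (0 + j)) + cmod (\<Sum>j\<in>{1..<N}. v j)"
      by (metis norm_triangle_ineq4)
    also have "\<dots> \<le> \<rho> + (\<Sum>j\<in>{1..<N}. 2 * of_int (K + 1) * \<rho>)"
      using N K True others by (intro add_mono win sum_norm_le) auto
    also have "\<dots> = (1 + 2 * of_int ((N - 1) * (K + 1))) * \<rho>"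
      using N by (simp add: algebra_simps)
    also have "\<dots> \<le> (1 + 2 * of_int (N * (K + 1))) * \<rho>"
    proof (intro mult_right_mono \<rho>)
      have "(N - 1) * (K + 1) \<le> N * (K + 1)" using K by (intro mult_right_mono) auto
      then have "real_of_int ((N - 1) * (K + 1)) \<le> of_int (N * (K + 1))" by (simp only: of_int_le_iff)
      then show "1 + 2 * real_of_int ((N - 1) * (K + 1)) \<le> 1 + 2 * of_int (N * (K + 1))" by simp
    qed
    finally show ?thesis .
  qed
qed

subsection \<open>The frame property\<close>

text \<open>A row of the Ron--Shen matrix sums the samples over \<open>k\<close> or \<open>k + 1\<close> consecutive points of a coset
  of \<open>b\<int>\<close>, according to the offset \<open>s\<close> of the first point. The locale describes both cases of the theorem at once:
  every row is a window of \<open>N\<close> samples, corrected by a single sample when \<open>s\<close> lies in \<open>[\<alpha>, \<alpha> + L)\<close>,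
  and uncorrected windows start everywhere.\<close>

locale gabor_window =
  fixes a b c :: real and k N :: int and \<alpha> L :: real and \<sigma> :: complex
  assumes a_pos: "0 < a" and b_pos: "0 < b" and c_pos: "0 < c" and k_def: "k = \<lfloor>c / b\<rfloor>"
    and k_nonneg: "0 \<le> k" and N_pos: "1 \<le> N" and N_le: "N \<le> k + 1" and L_nonneg: "0 \<le> L"
    and sigma: "cmod \<sigma> = 1" and arc: "0 \<le> \<alpha>" "\<alpha> + L \<le> b"
    and row: "\<And>(v :: int \<Rightarrow> complex) s. 0 \<le> s \<Longrightarrow> s < b \<Longrightarrow>
      (\<Sum>i\<in>{0..<k + 1}. indicator {0..<c} (s + of_int i * b) * v i)
      = (\<Sum>i\<in>{0..<N}. v i) + (if \<alpha> \<le> s \<and> s < \<alpha> + L then \<sigma> * v k else 0)"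
    and free: "\<And>u. \<exists>m::int. 0 \<le> u - of_int m * a \<and> u - of_int m * a < b \<and>
      \<not> (\<alpha> \<le> u - of_int m * a \<and> u - of_int m * a < \<alpha> + L)"
begin

lemma fiber_row:
  assumes "0 \<le> s" "s < b"
  shows "fiber a b c f m s = (\<Sum>i\<in>{0..<N}. f (of_int m * a + s + of_int i * b))
    + (if \<alpha> \<le> s \<and> s < \<alpha> + L then \<sigma> * f (of_int m * a + s + of_int k * b) else 0)"
  using row[OF assms, of "\<lambda>i. f (of_int m * a + (s + of_int i * b))"]
  by (simp add: fiber_def k_def add.assoc)

text \<open>The offset reduced modulo \<open>b\<close> in
  \<open>gabor_frame_indicator_if_pointwise\<close> belongs to the first coset point at or after
  \<open>m a\<close>, and \<open>i\<close> is the index of that point.\<close>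

lemma fiber_row_at:
  assumes s: "0 \<le> t + of_int i * b - of_int m * a" "t + of_int i * b - of_int m * a < b"
  shows "fiber a b c f m (t - of_int m * a - of_int \<lfloor>(t - of_int m * a) / b\<rfloor> * b)
    = (\<Sum>j\<in>{0..<N}. f (t + of_int (i + j) * b))
    + (if \<alpha> \<le> t + of_int i * b - of_int m * a \<and> t + of_int i * b - of_int m * a < \<alpha> + L
       then \<sigma> * f (t + of_int (i + k) * b) else 0)"
proof -
  have "t - of_int m * a \<in> {of_int (- i) * b..<(of_int (- i) + 1) * b}"
    using s by (auto simp: algebra_simps)
  then have "\<lfloor>(t - of_int m * a) / b\<rfloor> = - i"
    using floor_divide_eq_iff_tile[OF b_pos] by blast
  then have "t - of_int m * a - of_int \<lfloor>(t - of_int m * a) / b\<rfloor> * b = t + of_int i * b - of_int m * a" by simp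
  then show ?thesis
    by (simp only: fiber_row[OF s]) (simp add: algebra_simps)
qed

text \<open>Two rows that start at the same sample, one corrected and one not, differ by a single
  sample. Such samples are the small ones required by \<open>window_system_bound\<close>, while
  \<open>free\<close> supplies every window sum.\<close>

lemma frame_if_good_ratio:
  assumes L: "L > 0" and good: "\<not> bad_ratio a b N L"
  shows "gabor_frame (\<lambda>t. indicator {0..<c} t) a b"
proof -
  obtain K :: int where K: "K \<ge> 0" and hits: "\<And>t. \<exists>r0. \<forall>r\<in>{0..<N}. r \<noteq> r0 \<longrightarrow>
      (\<exists>l\<in>{0..K}. \<exists>m::int. 0 \<le> of_int (r + N * l) * b + t - of_int m * a \<and> of_int (r + N * l) * b + t - of_int m * a < L)"
    using all_but_one_class_hit[OF a_pos b_pos L N_pos good] by blast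
  \<comment> \<open>The rows used start at indices of absolute value at most
    \<open>N * (K + 1) + k\<close>; one further period accounts for the offset in
    \<open>[0, b)\<close>.\<close>
  define Q where "Q = N * (K + 1) + k + 1"
  define C where "C = 1 + 2 * real_of_int (N * (K + 1))"
  have NK: "0 \<le> N * (K + 1)" using N_pos K by simp
  have C1: "C \<ge> 1" using NK unfolding C_def by (simp del: of_int_mult of_int_add)
  show ?thesis
  proof (rule gabor_frame_indicator_if_pointwise[OF a_pos b_pos c_pos, of "C\<^sup>2" Q])
    show "C\<^sup>2 > 0" using C1 by simp
    show "Q \<ge> 0" using NK k_nonneg by (simp add: Q_def)
    fix f :: "real \<Rightarrow> complex" and t :: real
    define F where "F = (\<lambda>m. fiber a b c f m (t - of_int m * a - of_int \<lfloor>(t - of_int m * a) / b\<rfloor> * b))"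
    define M where "M = {m::int. \<bar>t - of_int m * a\<bar> \<le> of_int Q * b}"
    have M: "finite M" unfolding M_def by (rule finite_shifts_near[OF a_pos])
    define \<rho> where "\<rho> = sqrt (\<Sum>m\<in>M. (cmod (F m))\<^sup>2)"
    have sq: "\<rho>\<^sup>2 = (\<Sum>m\<in>M. (cmod (F m))\<^sup>2)" "\<rho> \<ge> 0"
      unfolding \<rho>_def by (simp_all add: sum_nonneg)
    have F: "cmod (F m) \<le> \<rho>" if "m \<in> M" for m
      unfolding \<rho>_def by (rule real_le_rsqrt) (rule member_le_sum[of _ _ "\<lambda>m. (cmod (F m))\<^sup>2"], use that M in auto)
    define v where "v = (\<lambda>j. f (t + of_int j * b))"
    have near: "m \<in> M" if s: "0 \<le> t + of_int i * b - of_int m * a" "t + of_int i * b - of_int m * a < b"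
      and i: "\<bar>i\<bar> \<le> N * (K + 1) + k" for i m
    proof -
      have "\<bar>t - of_int m * a\<bar> \<le> b + of_int \<bar>i\<bar> * b"
      proof -
        have "\<bar>of_int i * b\<bar> = of_int \<bar>i\<bar> * b" using b_pos by (simp add: abs_mult)
        then show ?thesis using s by linarith
      qed
      also have "\<dots> \<le> b + of_int (N * (K + 1) + k) * b"
        using i b_pos by (intro add_left_mono mult_right_mono of_int_le_iff[THEN iffD2]) auto
      finally show ?thesis by (simp add: M_def Q_def algebra_simps)
    qed
    have win: "cmod (\<Sum>j\<in>{0..<N}. v (i + j)) \<le> \<rho>" if i: "\<bar>i\<bar> \<le> N * (K + 1) + k" for i
    proof -
      obtain m :: int where m: "0 \<le> t + of_int i * b - of_int m * a" "t + of_int i * b - of_int m * a < b"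
        "\<not> (\<alpha> \<le> t + of_int i * b - of_int m * a \<and> t + of_int i * b - of_int m * a < \<alpha> + L)"
        using free[of "t + of_int i * b"] by blast
      have "F m = (\<Sum>j\<in>{0..<N}. v (i + j))"
        unfolding F_def fiber_row_at[OF m(1,2)] if_not_P[OF m(3)] v_def by simp
      then show ?thesis using F[OF near[OF m(1,2) i]] by simp
    qed
    \<comment> \<open>The correction involves sample \<open>i + k\<close>, and the arc starts at
      \<alpha>; shifting by \<open>k * b + \<alpha>\<close> turns this into the arc
      \<open>[0, L)\<close> for the index of the corrected sample.\<close>
    obtain r0 where r0: "\<forall>r\<in>{0..<N}. r \<noteq> r0 \<longrightarrow>
      (\<exists>l\<in>{0..K}. \<exists>m::int. 0 \<le> of_int (r + N * l) * b + (t - of_int k * b - \<alpha>) - of_int m * a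
        \<and> of_int (r + N * l) * b + (t - of_int k * b - \<alpha>) - of_int m * a < L)"
      using hits[of "t - of_int k * b - \<alpha>"] by blast
    have "cmod (v 0) \<le> C * \<rho>"
      unfolding C_def
    proof (rule window_system_bound[OF N_pos K sq(2)])
      show "cmod (\<Sum>j\<in>{0..<N}. v (i + j)) \<le> \<rho>" if "0 \<le> i" "i \<le> N * (K + 1)" for i
        using that k_nonneg by (intro win) simp
      fix r assume r: "r \<in> {0..<N}" "r \<noteq> r0"
      then obtain l m where l: "l \<in> {0..K}"
        and lm: "0 \<le> of_int (r + N * l) * b + (t - of_int k * b - \<alpha>) - of_int m * a"
          "of_int (r + N * l) * b + (t - of_int k * b - \<alpha>) - of_int m * a < L"
        using r0 by blast
      \<comment> \<open>The start of the row whose correction is the sample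
        \<open>r + N * l\<close>. It can be negative, hence the absolute values in
        \<open>near\<close> and \<open>win\<close>.\<close>
      define i where "i = r + N * l - k"
      have s: "\<alpha> \<le> t + of_int i * b - of_int m * a" "t + of_int i * b - of_int m * a < \<alpha> + L"
        using lm by (auto simp: i_def algebra_simps)
      have s': "0 \<le> t + of_int i * b - of_int m * a" "t + of_int i * b - of_int m * a < b"
        using s arc by auto
      have "0 \<le> N * l" "N * l \<le> N * K" using l N_pos by auto
      then have i: "\<bar>i\<bar> \<le> N * (K + 1) + k"
        using r k_nonneg N_pos unfolding i_def distrib_left mult_1_right atLeastLessThan_iff by linarith
      have "F m = (\<Sum>j\<in>{0..<N}. v (i + j)) + \<sigma> * v (i + k)"
        unfolding F_def fiber_row_at[OF s'] if_P[OF conjI[OF s]] v_def by simp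
      then have "\<sigma> * v (i + k) = F m - (\<Sum>j\<in>{0..<N}. v (i + j))" by simp
      then have "cmod (\<sigma> * v (i + k)) \<le> cmod (F m) + cmod (\<Sum>j\<in>{0..<N}. v (i + j))"
        by (metis norm_triangle_ineq4)
      also have "\<dots> \<le> 2 * \<rho>" using F[OF near[OF s' i]] win[OF i] by simp
      finally have "cmod (v (r + N * l)) \<le> 2 * \<rho>" by (simp add: norm_mult sigma i_def)
      then show "\<exists>l\<in>{0..K}. cmod (v (r + N * l)) \<le> 2 * \<rho>" using l by blast
    qed
    then have "(cmod (f t))\<^sup>2 \<le> (C * \<rho>)\<^sup>2" by (intro power_mono) (simp_all add: v_def)
    then show "(cmod (f t))\<^sup>2 \<le> C\<^sup>2 * (\<Sum>m | \<bar>t - of_int m * a\<bar> \<le> of_int Q * b.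
       (cmod (fiber a b c f m (t - of_int m * a - of_int \<lfloor>(t - of_int m * a) / b\<rfloor> * b)))\<^sup>2)"
      unfolding power_mult_distrib sq(1) by (simp add: M_def F_def)
  qed
qed

text \<open>The test functions carry a null vector \<open>v\<close> on the cells
  \<open>[T + j b, T + j b + e)\<close> for \<open>0 \<le> j < N J\<close>. Their squared norms grow
  at least linearly in \<open>J\<close>. Rows inside see only zero windows and vanishing
  corrections, and the rows across the two ends are boundedly many with bounded energy, so no lower
  bound survives.\<close>

lemma not_frame_if_two_classes_missed:
  fixes \<tau> \<epsilon> :: real and r :: int
  assumes eps: "\<epsilon> > 0" and r: "\<not> N dvd r"
    and miss: "\<And>t j m. \<tau> \<le> t \<Longrightarrow> t < \<tau> + \<epsilon> \<Longrightarrow> N dvd j \<or> N dvd j - r \<Longrightarrow>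
       \<not> (0 \<le> of_int j * b + t - of_int m * a \<and> of_int j * b + t - of_int m * a < L)"
  shows "\<not> gabor_frame (\<lambda>t. indicator {0..<c} t) a b"
proof
  assume "gabor_frame (\<lambda>t. indicator {0..<c} t) a b"
  then obtain A where A: "A > 0" "\<And>f. L2 f \<Longrightarrow> A * L2_normsq f \<le> infsum (fiber_energy a b c f) UNIV"
    unfolding gabor_frame_indicator_iff[OF a_pos b_pos c_pos] by blast
  define e where "e = min \<epsilon> b"
  have e: "e > 0" "e \<le> \<epsilon>" "e \<le> b" using eps b_pos by (auto simp: e_def)
  \<comment> \<open>The shift by \<open>k * b + \<alpha>\<close> turns the arc condition for the
    correction sample \<open>i + k\<close> into the one excluded by \<open>miss\<close>.\<close>
  define T where "T = \<tau> + of_int k * b + \<alpha>"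
  \<comment> \<open>One class minus another: every window of \<open>N\<close> samples sums to zero,
    and \<open>\<not> N dvd r\<close> keeps \<open>v\<close> nonzero.\<close>
  define v :: "int \<Rightarrow> complex" where "v = (\<lambda>j. of_bool (N dvd j) - of_bool (N dvd j - r))"
  have v_le: "cmod (v j) \<le> 1" for j by (auto simp: v_def)
  have v_0: "cmod (v (N * l)) = 1" for l
  proof -
    have "\<not> N dvd N * l - r" using r by (metis dvd_diff_commute dvd_triv_left zdvd_zdiffD)
    then show ?thesis by (simp add: v_def)
  qed
  have v_sum: "(\<Sum>j\<in>{0..<N}. v (i + j)) = 0" for i
  proof -
    have one: "(\<Sum>j\<in>{0..<N}. of_bool (N dvd i + j - x)) = (1 :: complex)" for x
    proof -
      define y where "y = (x - i) mod N"
      have "{0..<N} \<inter> {j. N dvd i + j - x} = {y}"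
      proof (intro equalityI subsetI)
        fix j assume j: "j \<in> {0..<N} \<inter> {j. N dvd i + j - x}"
        then have "N dvd j - (x - i)" by (simp add: algebra_simps)
        then have "j mod N = y" by (simp add: y_def mod_eq_dvd_iff)
        then show "j \<in> {y}" using j by simp
      next
        fix j assume "j \<in> {y}"
        then have j: "j = (x - i) mod N" by (simp add: y_def)
        then have "N dvd j - (x - i)" by (metis mod_eq_dvd_iff mod_mod_trivial)
        then have "N dvd i + j - x" by (simp add: algebra_simps)
        then show "j \<in> {0..<N} \<inter> {j. N dvd i + j - x}" using j N_pos by simp
      qed
      then show ?thesis by (simp add: of_bool_def sum.If_cases)
    qed
    show ?thesis using one[of 0] one[of r] by (simp add: v_def sum_subtractf)
  qed
  \<comment> \<open>\<open>R\<close> bounds the distance from an end of the support to the start of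
    a row straddling it, \<open>D\<close> the energy of one row, and \<open>B\<close> the energy of
    all straddling rows, independently of \<open>J\<close>.\<close>
  define R where "R = (of_int k + 2) * b"
  define D where "D = of_int (k + 1) * c"
  define B where "B = 2 * ((2 * R + 1) / a + 1) * D"
  have main: "A * (real J * e) \<le> B" for J :: nat
  proof -
    define NJ where "NJ = N * int J"
    define f where "f = (\<lambda>t. \<Sum>j\<in>{0..<NJ}. indicator {T + of_int j * b..<T + of_int j * b + e} t * v j)"
    have [measurable]: "f \<in> borel_measurable borel" unfolding f_def by measurable
    have ind: "indicator {T + of_int j * b..<T + of_int j * b + e} t
        = (if j = \<lfloor>(t - T) / b\<rfloor> \<and> t - T - of_int \<lfloor>(t - T) / b\<rfloor> * b < e then 1 else 0 :: 'x::{zero_neq_one})" for j t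
    proof -
      have "t \<in> {T + of_int j * b..<T + of_int j * b + e} \<longleftrightarrow>
        t - T \<in> {of_int j * b..<(of_int j + 1) * b} \<and> t - T - of_int j * b < e"
        using e(3) by (auto simp: algebra_simps)
      then show ?thesis
        unfolding floor_divide_eq_iff_tile[OF b_pos] by (auto simp: indicator_def)
    qed
    have f_eq: "f t = (if \<lfloor>(t - T) / b\<rfloor> \<in> {0..<NJ} \<and> t - T - of_int \<lfloor>(t - T) / b\<rfloor> * b < e then v \<lfloor>(t - T) / b\<rfloor> else 0)" for t
      unfolding f_def ind by (cases "t - T - of_int \<lfloor>(t - T) / b\<rfloor> * b < e") (simp_all add: if_distrib[where f = "\<lambda>x. x * _"] cong: if_cong)
    have f_le: "cmod (f t) \<le> 1" for t unfolding f_eq using v_le by simp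
    have f_sq: "(cmod (f t))\<^sup>2 = (\<Sum>j\<in>{0..<NJ}. indicator {T + of_int j * b..<T + of_int j * b + e} t * (cmod (v j))\<^sup>2)" for t
      unfolding f_eq ind by (cases "t - T - of_int \<lfloor>(t - T) / b\<rfloor> * b < e") (simp_all add: if_distrib[where f = "\<lambda>x. x * _"] cong: if_cong)
    have "has_bochner_integral lborel (\<lambda>t. (cmod (f t))\<^sup>2) (\<Sum>j\<in>{0..<NJ}. e * (cmod (v j))\<^sup>2)"
      unfolding f_sq
    proof (intro has_bochner_integral_sum has_bochner_integral_mult_left)
      fix j
      show "has_bochner_integral lborel (indicator {T + of_int j * b..<T + of_int j * b + e}) e"
        using has_bochner_integral_real_indicator[of "{T + of_int j * b..<T + of_int j * b + e}" lborel] e(1)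
        by simp
    qed
    then have f: "L2 f" and norm: "L2_normsq f = (\<Sum>j\<in>{0..<NJ}. e * (cmod (v j))\<^sup>2)"
      by (auto simp: L2_def L2_normsq_def has_bochner_integral_iff)
    have "real J * e \<le> L2_normsq f"
    proof -
      \<comment> \<open>Only the cells whose index is a multiple of \<open>N\<close> are counted;
        each contributes \<open>e\<close>.\<close>
      have "real J * e = (\<Sum>l\<in>{0..<int J}. e * (cmod (v (N * l)))\<^sup>2)" by (simp add: v_0)
      also have "\<dots> = (\<Sum>j\<in>(\<lambda>l. N * l) ` {0..<int J}. e * (cmod (v j))\<^sup>2)"
        using N_pos by (subst sum.reindex) (auto simp: inj_on_def)
      also have "\<dots> \<le> (\<Sum>j\<in>{0..<NJ}. e * (cmod (v j))\<^sup>2)"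
        using N_pos e(1) by (intro sum_mono2) (auto simp: NJ_def)
      finally show ?thesis by (simp add: norm)
    qed
    then have "A * (real J * e) \<le> A * L2_normsq f" using A(1) by simp
    also have "\<dots> \<le> infsum (fiber_energy a b c f) UNIV" by (rule A(2)[OF f])
    also have "\<dots> \<le> B"
    proof -
      define X where "X = (\<lambda>x. {m::int. \<bar>x - of_int m * a\<bar> \<le> R})"
      define Bad where "Bad = X T \<union> X (T + of_int NJ * b)"
      have finX: "finite (X x)" for x unfolding X_def by (rule finite_shifts_near[OF a_pos])
      have R: "R \<ge> 0" using k_nonneg b_pos by (simp add: R_def)
      \<comment> \<open>The extra \<open>1\<close> fits the closed interval of radius
        \<open>R\<close> into the half-open window of \<open>card_window_shifts_le\<close>.\<close>
      have cardX: "real (card (X x)) \<le> (2 * R + 1) / a + 1" for x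
        using R by (intro card_window_shifts_le[OF a_pos _ finX, where t = "x + R"]) (auto simp: X_def abs_le_iff)
      have "card Bad \<le> card (X T) + card (X (T + of_int NJ * b))" unfolding Bad_def by (rule card_Un_le)
      then have "real (card Bad) \<le> real (card (X T) + card (X (T + of_int NJ * b)))"
        by (simp only: of_nat_le_iff)
      then have cardBad: "real (card Bad) \<le> 2 * ((2 * R + 1) / a + 1)"
        using add_mono[OF cardX[of T] cardX[of "T + of_int NJ * b"]] unfolding mult_2 of_nat_add by linarith
      have D: "D \<ge> 0" using k_nonneg c_pos by (simp add: D_def)
      have en_le: "fiber_energy a b c f m \<le> D" for m
      proof -
        have "ennreal (fiber_energy a b c f m) \<le> ennreal (of_int (\<lfloor>c / b\<rfloor> + 1)) *
          (\<integral>\<^sup>+t. ennreal ((cmod (f t))\<^sup>2) * indicator {of_int m * a..<of_int m * a + c} t \<partial>lborel)"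
          unfolding ennreal_fiber_energy[OF b_pos c_pos f] by (rule nn_integral_fiber_le[OF b_pos c_pos]) measurable
        also have "\<dots> \<le> ennreal (of_int (k + 1)) * (\<integral>\<^sup>+t. indicator {of_int m * a..<of_int m * a + c} t \<partial>lborel)"
        proof -
          have "ennreal ((cmod (f t))\<^sup>2) \<le> 1" for t
            using power_mono[OF f_le[of t], of 2] by (simp add: ennreal_le_1)
          then show ?thesis
            unfolding k_def by (intro mult_left_mono nn_integral_mono) (auto split: split_indicator)
        qed
        also have "\<dots> = ennreal D"
          using c_pos k_nonneg by (simp add: D_def ennreal_mult[symmetric] del: of_int_add ennreal_plus)
        finally show ?thesis using D by simp
      qed
      have en_0: "fiber_energy a b c f m = 0" if m: "m \<notin> Bad" for m
      proof -
        have "fiber a b c f m s = 0" if s: "0 \<le> s" "s < b" for s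
        proof -
          define t where "t = of_int m * a + s"
          \<comment> \<open>The first point of the row lies in period \<open>i\<close>, counted from
            \<open>T\<close>, at position \<open>x\<close>; the row therefore sees at most the
            periods from \<open>i\<close> to \<open>i + k\<close>.\<close>
          define i where "i = \<lfloor>(t - T) / b\<rfloor>"
          define x where "x = t - T - of_int i * b"
          have x: "0 \<le> x" "x < b"
            using floor_divide_lower[OF b_pos, of "t - T"] floor_divide_upper[OF b_pos, of "t - T"]
            unfolding x_def i_def by (auto simp: algebra_simps)
          have shift: "\<lfloor>(t + of_int j * b - T) / b\<rfloor> = i + j" for j
          proof -
            have "(t + of_int j * b - T) / b = (t - T) / b + of_int j" using b_pos by (simp add: field_simps)
            then show ?thesis by (simp add: i_def)
          qed
          have ft: "f (t + of_int j * b) = (if i + j \<in> {0..<NJ} \<and> x < e then v (i + j) else 0)" for j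
            unfolding f_eq shift by (simp add: x_def algebra_simps)
          have fib: "fiber a b c f m s = (\<Sum>j\<in>{0..<N}. f (t + of_int j * b))
            + (if \<alpha> \<le> s \<and> s < \<alpha> + L then \<sigma> * f (t + of_int k * b) else 0)"
            unfolding t_def by (rule fiber_row[OF s])
          \<comment> \<open>The row passes between the cells, lies to the left or to the right of
            the support, lies inside it, or straddles its left or right end; the last two force
            \<open>m\<close> into \<open>Bad\<close>.\<close>
          consider "x \<ge> e" | "i + k < 0" | "i \<ge> NJ" | "x < e" "0 \<le> i" "i + k < NJ"
            | "i < 0" "0 \<le> i + k" | "i < NJ" "NJ \<le> i + k" by linarith
          then show ?thesis
          proof cases
            case 1
            then show ?thesis unfolding fib ft by simp
          next
            case 2
            then have "(\<Sum>j\<in>{0..<N}. f (t + of_int j * b)) = 0" using N_le unfolding ft by (intro sum.neutral) auto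
            moreover have "f (t + of_int k * b) = 0" using 2 unfolding ft by simp
            ultimately show ?thesis unfolding fib by simp
          next
            case 3
            then have "(\<Sum>j\<in>{0..<N}. f (t + of_int j * b)) = 0" unfolding ft by (intro sum.neutral) auto
            moreover have "f (t + of_int k * b) = 0" using 3 k_nonneg unfolding ft by simp
            ultimately show ?thesis unfolding fib by simp
          next
            case 4
            have "(\<Sum>j\<in>{0..<N}. f (t + of_int j * b)) = (\<Sum>j\<in>{0..<N}. v (i + j))"
              using 4 N_le unfolding ft by (intro sum.cong) auto
            moreover have "f (t + of_int k * b) = 0" if "\<alpha> \<le> s \<and> s < \<alpha> + L"
            proof -
              have "of_int (i + k) * b + (\<tau> + x) - of_int m * a = s - \<alpha>"
                by (simp add: x_def t_def T_def algebra_simps)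
              then have "\<not> (N dvd i + k \<or> N dvd i + k - r)"
                using miss[of "\<tau> + x" "i + k" m] x e(2) 4(1) that by auto
              then have "v (i + k) = 0" by (simp add: v_def)
              then show ?thesis unfolding ft by simp
            qed
            ultimately show ?thesis unfolding fib v_sum by auto
          next
            case 5
            have "\<bar>T - of_int m * a\<bar> \<le> R"
            proof -
              have "T - of_int m * a = s - x - of_int i * b" by (simp add: x_def t_def)
              moreover have "\<bar>of_int i * b\<bar> \<le> of_int k * b"
                unfolding abs_mult using 5 b_pos by (intro mult_mono) auto
              ultimately show ?thesis using s x b_pos unfolding R_def distrib_right by linarith
            qed
            then show ?thesis using m by (simp add: Bad_def X_def)
          next
            case 6
            have "\<bar>T + of_int NJ * b - of_int m * a\<bar> \<le> R"
            proof -
              have "T + of_int NJ * b - of_int m * a = s - x + of_int (NJ - i) * b"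
                by (simp add: x_def t_def algebra_simps)
              moreover have "\<bar>of_int (NJ - i) * b\<bar> \<le> of_int k * b"
                unfolding abs_mult using 6 b_pos by (intro mult_mono) auto
              ultimately show ?thesis using s x b_pos unfolding R_def distrib_right by linarith
            qed
            then show ?thesis using m by (simp add: Bad_def X_def)
          qed
        qed
        then have "AE s in period_measure b. (cmod (fiber a b c f m s))\<^sup>2 = 0"
          by (intro AE_period_measure AE_I2) auto
        then have "fiber_energy a b c f m = (\<integral>s. 0 \<partial>period_measure b)"
          unfolding fiber_energy_def using fiber_measurable[of f a b c m]
          by (intro integral_cong_AE) auto
        then show ?thesis by simp
      qed
      show "infsum (fiber_energy a b c f) UNIV \<le> B"
      proof (rule infsum_le_finite_sums[OF summable_fiber_energy[OF a_pos b_pos c_pos f]])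
        fix M :: "int set" assume M: "finite M"
        have "sum (fiber_energy a b c f) M = sum (fiber_energy a b c f) (M \<inter> Bad)"
          using M en_0 by (intro sum.mono_neutral_right) auto
        also have "\<dots> \<le> sum (fiber_energy a b c f) Bad"
          using finX by (intro sum_mono2) (auto simp: Bad_def fiber_energy_nonneg)
        also have "\<dots> \<le> real (card Bad) * D"
          using sum_bounded_above[of Bad "fiber_energy a b c f" D] en_le by simp
        also have "\<dots> \<le> B" unfolding B_def using cardBad D by (intro mult_right_mono)
        finally show "sum (fiber_energy a b c f) M \<le> B" .
      qed
    qed
    finally show ?thesis .
  qed
  obtain J :: nat where J: "B / (A * e) < real J" using reals_Archimedean2 by blast
  then have "B < A * (real J * e)" using A(1) e(1) by (simp add: field_simps)
  then show False using main[of J] by simp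
qed

text \<open>For \<open>L = 0\<close> all rows are uncorrected windows; with \<open>N = 1\<close>
  these would be single samples and determine \<open>f\<close>, hence the assumption
  \<open>N2\<close>.\<close>

theorem not_gabor_frame_iff:
  assumes N2: "L = 0 \<Longrightarrow> N \<ge> 2"
  shows "\<not> gabor_frame (\<lambda>t. indicator {0..<c} t) a b \<longleftrightarrow> L = 0 \<or> bad_ratio a b N L"
proof
  show "L = 0 \<or> bad_ratio a b N L" if "\<not> gabor_frame (\<lambda>t. indicator {0..<c} t) a b"
    using frame_if_good_ratio that L_nonneg by fastforce
next
  assume "L = 0 \<or> bad_ratio a b N L"
  then show "\<not> gabor_frame (\<lambda>t. indicator {0..<c} t) a b"
  proof
    assume L: "L = 0"
    \<comment> \<open>The empty arc is never hit, so the classes of \<open>0\<close> and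
      \<open>1\<close> serve as the two missed classes.\<close>
    then have "\<not> N dvd 1" using N2 by auto
    then show ?thesis
      using L by (intro not_frame_if_two_classes_missed[of 1 1 0]) auto
  next
    assume "bad_ratio a b N L"
    from two_classes_missed[OF a_pos b_pos L_nonneg N_pos this] show ?thesis
      using not_frame_if_two_classes_missed by metis
  qed
qed

end

section \<open>The rows of the indicator window and the two cases of the theorem\<close>

lemma sum_window:
  fixes v :: "int \<Rightarrow> complex" and b c :: real
  assumes b: "b > 0" and k: "k = \<lfloor>c / b\<rfloor>" "k \<ge> 0" and s: "0 \<le> s" "s < b"
  shows "(\<Sum>i\<in>{0..<k + 1}. indicator {0..<c} (s + of_int i * b) * v i)
    = (\<Sum>i\<in>{0..<k}. v i) + (if s < c - of_int k * b then v k else 0)"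
proof -
  have kc: "of_int k * b \<le> c" using floor_divide_lower[OF b, of c] by (simp add: k)
  have "sum g {0..<k + 1} = sum g {0..<k} + g k" for g :: "int \<Rightarrow> complex"
  proof -
    have "{0..<k + 1} = insert k {0..<k}" using k by auto
    then show ?thesis by (simp add: add.commute)
  qed
  then have "(\<Sum>i\<in>{0..<k + 1}. indicator {0..<c} (s + of_int i * b) * v i)
    = (\<Sum>i\<in>{0..<k}. indicator {0..<c} (s + of_int i * b) * v i) + indicator {0..<c} (s + of_int k * b) * v k"
    by this
  also have "(\<Sum>i\<in>{0..<k}. indicator {0..<c} (s + of_int i * b) * v i) = (\<Sum>i\<in>{0..<k}. v i)"
  proof (rule sum.cong)
    fix i assume i: "i \<in> {0..<k}"
    then have "of_int (i + 1) * b \<le> of_int k * b" using b by (intro mult_right_mono) auto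
    moreover have "0 \<le> of_int i * b" using i b by simp
    ultimately have "s + of_int i * b \<in> {0..<c}" using s kc by (auto simp: algebra_simps)
    then show "indicator {0..<c} (s + of_int i * b) * v i = v i" by simp
  qed simp
  also have "indicator {0..<c} (s + of_int k * b) * v k = (if s < c - of_int k * b then v k else 0)"
    using s b k by (auto simp: indicator_def algebra_simps intro!: add_nonneg_nonneg mult_nonneg_nonneg)
  finally show ?thesis .
qed

theorem theorem2p2:
  fixes a b c c0 :: real and k :: int
  assumes "0 < a" and "a < b" and "b < c"
    and k_def: "k = \<lfloor>c / b\<rfloor>"
    and c0_def: "c0 = c - of_int k * b"
  shows
    "(c0 \<ge> a \<and> c0 > b - a \<longrightarrow>
       (\<not> gabor_frame (\<lambda>t. indicator {0..<c} t) a b \<longleftrightarrow>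
         (\<exists>p q :: int. 0 < p \<and> 0 < q \<and> coprime p q \<and> a / b = of_int p / of_int q \<and>
            ((c0 > b - of_int (gcd (k + 1) p) * b / of_int q \<and> gcd (k + 1) p \<noteq> k + 1) \<or>
             (c0 > b - of_int (gcd (k + 1) p) * b / of_int q + b / of_int q \<and> gcd (k + 1) p = k + 1)))))
     \<and>
     (c0 < a \<and> c0 \<le> b - a \<longrightarrow>
       (\<not> gabor_frame (\<lambda>t. indicator {0..<c} t) a b \<longleftrightarrow>
         (c0 = 0 \<or>
          (\<exists>p q :: int. 0 < p \<and> 0 < q \<and> coprime p q \<and> a / b = of_int p / of_int q \<and>
             0 < c0 \<and> c0 < of_int (gcd k p) * b / of_int q \<and> gcd k p \<noteq> k) \<or>
          (\<exists>p q :: int. 0 < p \<and> 0 < q \<and> coprime p q \<and> a / b = of_int p / of_int q \<and>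
             0 < c0 \<and> c0 < of_int (gcd k p) * b / of_int q - b / of_int q \<and> gcd k p = k))))"
proof -
  have b: "b > 0" and c: "c > 0" using assms by auto
  have k1: "k \<ge> 1" using assms b by (simp add: k_def le_floor_iff)
  have c0: "0 \<le> c0" "c0 < b"
    using floor_divide_lower[OF b, of c] floor_divide_upper[OF b, of c]
    by (auto simp: c0_def k_def algebra_simps)
  note window = sum_window[OF b k_def, folded c0_def]
  show ?thesis
  proof (intro conjI impI; elim conjE)
    assume A: "a \<le> c0" "b - a < c0"
    \<comment> \<open>Each row is a window of \<open>k + 1\<close> samples from which the last is
      removed when \<open>s \<ge> c0\<close>; hence the arc \<open>[c0, b)\<close> and the sign
      \<open>- 1\<close>.\<close>
    interpret gabor_window a b c k "k + 1" c0 "b - c0" "- 1"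
    proof
      fix v :: "int \<Rightarrow> complex" and s :: real assume s: "0 \<le> s" "s < b"
      have "{0..<k + 1} = insert k {0..<k}" using k1 by auto
      then show "(\<Sum>i\<in>{0..<k + 1}. indicator {0..<c} (s + of_int i * b) * v i)
        = (\<Sum>i\<in>{0..<k + 1}. v i) + (if c0 \<le> s \<and> s < c0 + (b - c0) then - 1 * v k else 0)"
        using window[OF _ s, of v] k1 s by simp
    next
      fix u :: real
      \<comment> \<open>An offset chosen in \<open>[0, a)\<close> lies below the arc, since
        \<open>a \<le> c0\<close>.\<close>
      show "\<exists>m::int. 0 \<le> u - of_int m * a \<and> u - of_int m * a < b \<and>
        \<not> (c0 \<le> u - of_int m * a \<and> u - of_int m * a < c0 + (b - c0))"
        using floor_divide_lower[OF \<open>0 < a\<close>, of u] floor_divide_upper[OF \<open>0 < a\<close>, of u] A(1) \<open>a < b\<close>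
        by (intro exI[of _ "\<lfloor>u / a\<rfloor>"]) (auto simp: algebra_simps)
    qed (use assms b c k1 c0 in auto)
    have "\<not> gabor_frame (\<lambda>t. indicator {0..<c} t) a b \<longleftrightarrow> b - c0 = 0 \<or> bad_ratio a b (k + 1) (b - c0)"
      by (rule not_gabor_frame_iff) (use k1 in auto)
    also have "\<dots> \<longleftrightarrow> bad_ratio a b (k + 1) (b - c0)" using c0 by simp
    finally show "\<not> gabor_frame (\<lambda>t. indicator {0..<c} t) a b \<longleftrightarrow>
         (\<exists>p q :: int. 0 < p \<and> 0 < q \<and> coprime p q \<and> a / b = of_int p / of_int q \<and>
            ((c0 > b - of_int (gcd (k + 1) p) * b / of_int q \<and> gcd (k + 1) p \<noteq> k + 1) \<or>
             (c0 > b - of_int (gcd (k + 1) p) * b / of_int q + b / of_int q \<and> gcd (k + 1) p = k + 1)))"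
      unfolding bad_ratio_def by (smt (verit))
  next
    assume A: "c0 < a" "c0 \<le> b - a"
    \<comment> \<open>Each row is a window of \<open>k\<close> samples to which sample
      \<open>k\<close> is added when \<open>s < c0\<close>; hence the arc \<open>[0, c0)\<close> and
      the sign \<open>1\<close>.\<close>
    interpret gabor_window a b c k k 0 c0 1
    proof
      fix v :: "int \<Rightarrow> complex" and s :: real assume s: "0 \<le> s" "s < b"
      show "(\<Sum>i\<in>{0..<k + 1}. indicator {0..<c} (s + of_int i * b) * v i)
        = (\<Sum>i\<in>{0..<k}. v i) + (if 0 \<le> s \<and> s < 0 + c0 then 1 * v k else 0)"
        using window[OF _ s, of v] k1 s by simp
    next
      fix u :: real
      \<comment> \<open>An offset chosen in \<open>[b - a, b)\<close> lies above the arc, since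
        \<open>c0 \<le> b - a\<close>.\<close>
      show "\<exists>m::int. 0 \<le> u - of_int m * a \<and> u - of_int m * a < b \<and>
        \<not> (0 \<le> u - of_int m * a \<and> u - of_int m * a < 0 + c0)"
        using floor_divide_lower[OF \<open>0 < a\<close>, of "u - (b - a)"] floor_divide_upper[OF \<open>0 < a\<close>, of "u - (b - a)"] A(2) \<open>a < b\<close>
        by (intro exI[of _ "\<lfloor>(u - (b - a)) / a\<rfloor>"]) (auto simp: algebra_simps)
    qed (use assms b c k1 c0 in auto)
    have "\<not> gabor_frame (\<lambda>t. indicator {0..<c} t) a b \<longleftrightarrow> c0 = 0 \<or> bad_ratio a b k c0"
    proof (rule not_gabor_frame_iff)
      assume "c0 = 0"
      \<comment> \<open>With \<open>c0 = 0\<close>, the value \<open>k = 1\<close> would mean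
        \<open>c = b\<close>.\<close>
      then have "k \<noteq> 1" using \<open>b < c\<close> by (auto simp: c0_def)
      then show "k \<ge> 2" using k1 by simp
    qed
    then show "\<not> gabor_frame (\<lambda>t. indicator {0..<c} t) a b \<longleftrightarrow>
         (c0 = 0 \<or>
          (\<exists>p q :: int. 0 < p \<and> 0 < q \<and> coprime p q \<and> a / b = of_int p / of_int q \<and>
             0 < c0 \<and> c0 < of_int (gcd k p) * b / of_int q \<and> gcd k p \<noteq> k) \<or>
          (\<exists>p q :: int. 0 < p \<and> 0 < q \<and> coprime p q \<and> a / b = of_int p / of_int q \<and>
             0 < c0 \<and> c0 < of_int (gcd k p) * b / of_int q - b / of_int q \<and> gcd k p = k))"
      unfolding bad_ratio_def using c0(1) by (smt (verit))
  qed
qed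

end
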